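(* Assume (A1)–(A5). Let $k\in\mathbb{Z}^+$. Then there exists a probability mass function $\mathbb{P}_L$ on $\mathbb{Z}^+$ with $\mathbb{P}_L(l)>0$ for all $l$ such that the following holds. Let $L\sim\mathbb{P}_L$ be independent of the level-0 chain and of all increment chains $(Z_{n,l,l-1})_{n}$, $l\ge 1$. Then for every bounded measurable $\varphi\in\mathrm{Lip}_{\tilde{\mathsf d}}(\mathsf X)$ the single-term estimator $$\widehat{\pi(\varphi)}_{S,k}:=\frac{1}{\mathbb{P}_L(L)}\Big(\mathbb{I}_{\{L=0\}}\,\widehat{\pi_0(\varphi)}_k+\mathbb{I}_{\{L\ge 1\}}\,\xi_{L,k}\Big)$$ satisfies $\mathbb{E}[\widehat{\pi(\varphi)}_{S,k}]=\pi(\varphi)$ and $\mathbb{E}[\widehat{\pi(\varphi)}_{S,k}^2]<\infty$.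
   Context: Setting. $(\mathsf X,\mathcal X)$ is a measurable space with $\mathsf X$ compact. $\tilde{\mathsf d}$ is a measurable metric on $\mathsf X$ with $\sup_{x,w\in\mathsf X}\tilde{\mathsf d}(x,w)<\infty$. $\pi$ and $(\pi_l)_{l\in\mathbb{Z}^+}$ are probability measures on $\mathsf X$, and $\Delta_l:=2^{-l}$. For each $l\in\mathbb{Z}^+$, $K_l$ is a Markov kernel on $\mathsf X$ with $\pi_lK_l=\pi_l$, and $\nu_l$ is a probability measure on $\mathsf X$. For a Markov kernel $K$ and bounded measurable $\varphi$, $K(\varphi)(x)=\int\varphi(x')K(x,dx')$, $K^n$ is the $n$-fold iterated kernel ($K^0$ the identity), and $\mu(\varphi)=\int\varphi\,d\mu$. $\|\mu-\nu\|_{tv}=\sup_{A\in\mathcal X}|\mu(A)-\nu(A)|$. $\|\varphi\|_\infty=\sup_x|\varphi(x)|$; $\mathrm{Lip}_{\tilde{\mathsf d}}(\mathsf X)$ is the set of $\varphi:\mathsf X\to\mathbb R$ with $|\varphi(x)-\varphi(w)|\le c\,\tilde{\mathsf d}(x,w)$ for some $c<\infty$ and all $x,w$, and $\|\varphi\|_{\mathrm{Lip}}$ is the smallest such $c$. $\mathbb{Z}^+=\{0,1,2,\dots\}$, $\mathbb N=\{1,2,\dots\}$. For $s\in\mathbb{Z}^+$, let $\tilde\nu_s$ be a probability measure on $\mathsf X^2$ both of whose marginals equal $\nu_s$, and let $\check\nu_s(d(x,w)):=\int\tilde\nu_s(d(x',w'))K_s(x',dx)\delta_{w'}(dw)$.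 Level-0 chain. $(X_{n,0},W_{n,0})_{n\ge0}$ is a Markov chain on $\mathsf X^2$ with initial law $\check\nu_0$ and transition kernel $\check K_0$, where $\check K_0((x,w),\cdot)$ is a probability measure on $\mathsf X^2$ with first marginal $K_0(x,\cdot)$ and second marginal $K_0(w,\cdot)$. Its meeting time is $\tau_0=\inf\{n\ge1:X_{n,0}=W_{n,0}\}$, and the chain is faithful: $X_{n,0}=W_{n,0}$ for all $n\ge\tau_0$. Increment chains. For each $l\in\mathbb N$, $(Z_{n,l,l-1})_{n\ge0}$ with $Z_{n,l,l-1}=((X_{n,l},W_{n,l}),(X_{n,l-1},W_{n,l-1}))$ is a Markov chain on $\mathsf X^4$ with transition kernel $\check K_{l,l-1}$ such that for every $z=((x_l,w_l),(x_{l-1},w_{l-1}))\in\mathsf X^4$ and $s\in\{l,l-1\}$, the image of $\check K_{l,l-1}(z,\cdot)$ under the coordinate $x_s'$ is $K_s(x_s,\cdot)$ and under the coordinate $w_s'$ is $K_s(w_s,\cdot)$; its initial law $\check\nu_{l,l-1}$ is such that, for each $s\in\{l,l-1\}$, $(X_{0,s},W_{0,s})$ has law $\check\nu_s$. Meeting times: $\tau_s=\inf\{n\ge1:X_{n,s}=W_{n,s}\}$ for $s\in\{l,l-1\}$, $\check\tau_{l,l-1}=\tau_l\vee\tau_{l-1}$, and faithfulness holds: $X_{n,s}=W_{n,s}$ for all $n\ge\tau_s$. Chains for different $l$ (and the level-0 chain) are independent. Estimators. For $k\in\mathbb Z^+$ and bounded measurable $\varphi$: $\widehat{\pi_s(\varphi)}_k:=\varphi(X_{k,s})+\sum_{n=k+1}^{\tau_s-1}\{\varphi(X_{n,s})-\varphi(W_{n,s})\}$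 (empty sums are $0$), computed from the level-0 chain when $s=0$ and from the chain $(Z_{n,l,l-1})$ when $s\in\{l,l-1\}$; and $\xi_{l,k}:=\widehat{\pi_l(\varphi)}_k-\widehat{\pi_{l-1}(\varphi)}_k$, both terms computed from $(Z_{n,l,l-1})_n$. Assumptions. (A1) There exist $C<\infty$, $\rho\in(0,1)$ with $\sup_{l\in\mathbb Z^+}\sup_{x\in\mathsf X}\|K_l^n(x,\cdot)-\pi_l\|_{tv}\le C\rho^n$ for all $n\in\mathbb N$. (A2) There exist $C<\infty$, $\rho\in(0,1)$ such that for all $n\in\mathbb N$: $\mathbb P(\tau_0>n)\le C\rho^n$, and for all $l\in\mathbb N$ and $s\in\{l,l-1\}$ the meeting time $\tau_s$ of the chain $(Z_{n,l,l-1})_n$ satisfies $\mathbb P(\tau_s>n)\le C\rho^n$. (A3) There exists $C<\infty$ such that for all $l\in\mathbb Z^+$, all bounded $\varphi\in\mathrm{Lip}_{\tilde{\mathsf d}}(\mathsf X)$ and all $x,w\in\mathsf X$: $|K_l(\varphi)(x)-K_l(\varphi)(w)|\le C(\|\varphi\|_\infty\vee\|\varphi\|_{\mathrm{Lip}})\tilde{\mathsf d}(x,w)$. (A4) There exist $C<\infty$, $\beta_1>0$ such that for all $l\in\mathbb N$ and bounded measurable $\varphi$: (i) $|\pi_l(\varphi)-\pi(\varphi)|\le C\|\varphi\|_\infty\Delta_l^{\beta_1}$; (ii) $\sup_{x}|K_l(\varphi)(x)-K_{l-1}(\varphi)(x)|\le C\|\varphi\|_\infty\Delta_l^{\beta_1}$.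 (A5) There exist $C<\infty$, $\beta_2>0$, $\epsilon>0$ such that, with $B_l:=\{(x_1,x_2,x_3,x_4)\in\mathsf X^4:\tilde{\mathsf d}(x_i,x_j)\le C\Delta_l^{\beta_2}\ \forall i,j\}$, for all $l,n\in\mathbb N$: $\mathbb P(Z_{0,l,l-1}\notin B_l)\le C\Delta_l^{\beta_2(2+\epsilon)}$ and $\mathbb P(Z_{n,l,l-1}\notin B_l,\ Z_{n-1,l,l-1}\in B_l)\le C\Delta_l^{\beta_2(2+\epsilon)}$. *)

theory Defs
  imports "HOL-Probability.Probability"
begin

definition Delta :: "nat \<Rightarrow> real" where
  "Delta l = 2 powr (- real l)"

definition tv_dist :: "'a measure \<Rightarrow> 'a measure \<Rightarrow> 'a measure \<Rightarrow> real" where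
  "tv_dist Mx mu nu = (SUP A \<in> sets Mx. \<bar>measure mu A - measure nu A\<bar>)"

primrec kpow :: "'a measure \<Rightarrow> ('a \<Rightarrow> 'a measure) \<Rightarrow> nat \<Rightarrow> 'a \<Rightarrow> 'a measure" where
  "kpow Mx K 0 x = return Mx x"
| "kpow Mx K (Suc n) x = bind (kpow Mx K n x) K"

definition kapp :: "('a \<Rightarrow> 'a measure) \<Rightarrow> ('a \<Rightarrow> real) \<Rightarrow> 'a \<Rightarrow> real" where
  "kapp K phi x = (\<integral>y. phi y \<partial>K x)"

text \<open>Supremum norm (the state space is the whole type).\<close>
definition sup_norm :: "('a \<Rightarrow> real) \<Rightarrow> real" where
  "sup_norm phi = (SUP x. \<bar>phi x\<bar>)"

definition bounded_fun :: "('a \<Rightarrow> real) \<Rightarrow> bool" where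
  "bounded_fun phi \<longleftrightarrow> (\<exists>B. \<forall>x. \<bar>phi x\<bar> \<le> B)"

definition is_lip :: "('a \<Rightarrow> 'a \<Rightarrow> real) \<Rightarrow> ('a \<Rightarrow> real) \<Rightarrow> bool" where
  "is_lip d phi \<longleftrightarrow> (\<exists>c. \<forall>x w. \<bar>phi x - phi w\<bar> \<le> c * d x w)"

definition lip_norm :: "('a \<Rightarrow> 'a \<Rightarrow> real) \<Rightarrow> ('a \<Rightarrow> real) \<Rightarrow> real" where
  "lip_norm d phi = Inf {c. 0 \<le> c \<and> (\<forall>x w. \<bar>phi x - phi w\<bar> \<le> c * d x w)}"

definition measurable_bounded_metric :: "'a measure \<Rightarrow> ('a \<Rightarrow> 'a \<Rightarrow> real) \<Rightarrow> bool" where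
  "measurable_bounded_metric Mx d \<longleftrightarrow>
     (\<forall>x w. 0 \<le> d x w) \<and> (\<forall>x w. d x w = 0 \<longleftrightarrow> x = w) \<and> (\<forall>x w. d x w = d w x) \<and>
     (\<forall>x y z. d x z \<le> d x y + d y z) \<and>
     (\<lambda>(x, w). d x w) \<in> borel_measurable (Mx \<Otimes>\<^sub>M Mx) \<and>
     (\<exists>B. \<forall>x w. d x w \<le> B)"

definition markov_kernel :: "'b measure \<Rightarrow> ('b \<Rightarrow> 'b measure) \<Rightarrow> bool" where
  "markov_kernel S K \<longleftrightarrow> K \<in> S \<rightarrow>\<^sub>M prob_algebra S"

primrec chain_fdd :: "'b measure \<Rightarrow> 'b measure \<Rightarrow> ('b \<Rightarrow> 'b measure) \<Rightarrow> nat \<Rightarrow> (nat \<Rightarrow> 'b) measure" where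
  "chain_fdd S init Kc 0 = distr init (PiM {0} (\<lambda>_. S)) (\<lambda>y. \<lambda>i\<in>{0}. y)"
| "chain_fdd S init Kc (Suc n) =
     bind (chain_fdd S init Kc n)
       (\<lambda>h. distr (Kc (h n)) (PiM {0..Suc n} (\<lambda>_. S)) (\<lambda>y. h(Suc n := y)))"

definition markov_chain :: "'w measure \<Rightarrow> 'b measure \<Rightarrow> 'b measure \<Rightarrow> ('b \<Rightarrow> 'b measure)
    \<Rightarrow> (nat \<Rightarrow> 'w \<Rightarrow> 'b) \<Rightarrow> bool" where
  "markov_chain M S init Kc Y \<longleftrightarrow>
     (\<forall>n. Y n \<in> M \<rightarrow>\<^sub>M S) \<and>
     (\<forall>n. distr M (PiM {0..n} (\<lambda>_. S)) (\<lambda>\<omega>. \<lambda>i\<in>{0..n}. Y i \<omega>) = chain_fdd S init Kc n)"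

definition meet :: "(nat \<Rightarrow> 'a) \<Rightarrow> (nat \<Rightarrow> 'a) \<Rightarrow> enat" where
  "meet x w = (if \<exists>n\<ge>1. x n = w n then enat (LEAST n. 1 \<le> n \<and> x n = w n) else \<infinity>)"

text \<open>Unbiased estimator phi(X_k) + sum_{n=k+1}^{tau-1} (phi(X_n) - phi(W_n)).
  On the (null, by (A2)) event tau = infinity its value is set to 0.\<close>
definition est :: "('a \<Rightarrow> real) \<Rightarrow> nat \<Rightarrow> (nat \<Rightarrow> 'a) \<Rightarrow> (nat \<Rightarrow> 'a) \<Rightarrow> real" where
  "est phi k x w = (case meet x w of
       enat t \<Rightarrow> phi (x k) + (\<Sum>n\<in>{k+1..<t}. phi (x n) - phi (w n))
     | \<infinity> \<Rightarrow> 0)"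

definition nucheck :: "'a measure \<Rightarrow> ('a \<Rightarrow> 'a measure) \<Rightarrow> ('a \<times> 'a) measure \<Rightarrow> ('a \<times> 'a) measure" where
  "nucheck Mx K nut = bind nut (\<lambda>(x', w'). distr (K x') (Mx \<Otimes>\<^sub>M Mx) (\<lambda>x. (x, w')))"

definition quad_close :: "('a \<Rightarrow> 'a \<Rightarrow> real) \<Rightarrow> real \<Rightarrow> ('a \<times> 'a) \<times> ('a \<times> 'a) \<Rightarrow> bool" where
  "quad_close d r z \<longleftrightarrow>
     (\<forall>a \<in> {fst (fst z), snd (fst z), fst (snd z), snd (snd z)}.
        \<forall>b \<in> {fst (fst z), snd (fst z), fst (snd z), snd (snd z)}. d a b \<le> r)"

end

theory Submission
  imports Defs
begin

text \<open>
  Faithfulness makes each estimator an almost surely finite series whose terms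
  \<open>\<phi>(X\<^sub>n) - \<phi>(W\<^sub>n)\<close> vanish after the meeting time. Since \<open>W\<^sub>n\<close> has law \<open>\<nu> K\<^sup>n\<close> and
  \<open>X\<^sub>n\<close> has law \<open>\<nu> K\<^sup>n\<^sup>+\<^sup>1\<close>, the expectations telescope to the limit of \<open>\<nu> K\<^sup>n(\<phi>)\<close>, which is
  \<open>\<pi>\<^sub>l(\<phi>)\<close> by (A1); a second telescoping over the levels gives \<open>\<pi>(\<phi>)\<close> by (A4).

  For the second moment, the \<open>n\<close>-th term of \<open>\<xi>\<^sub>l\<close> has second moment of order \<open>\<rho>\<^sup>n\<close> by (A2),
  and of order \<open>(n + 1) \<Delta>\<^sub>l\<close> to the power \<open>2 \<beta>\<^sub>2\<close> by (A5) and a union bound over the first exit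
  from \<open>B\<^sub>l\<close>. Interpolating the two bounds and applying a geometrically weighted
  Cauchy--Schwarz inequality yields \<open>E \<xi>\<^sub>l\<^sup>2 \<le> c \<Delta>\<^sub>l\<close> to the power \<open>\<beta>\<^sub>2\<close>, so that a geometric law
  of \<open>L\<close> with ratio \<open>2\<close> to the power \<open>- \<beta>\<^sub>2 / 2\<close> makes \<open>\<Sum>\<^sub>l E \<xi>\<^sub>l\<^sup>2 / P(L = l)\<close> finite.
\<close>

section \<open>Laws of coupled Markov chains\<close>

text \<open>Neither second-moment bound suffices alone: the tail of the meeting time does not shrink
  with the level, and the closeness bound grows linearly in \<open>n\<close>, so it cannot be
  summed. Their geometric mean halves both exponents. With the tail written as
  \<open>r ^ (4 * n)\<close>, it leaves \<open>r ^ (2 * n)\<close>; the Cauchy-Schwarz weights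
  consume \<open>r ^ n\<close>, and the remaining \<open>r ^ n\<close> is summable even against the
  linear factor. On the level side, closeness of order \<open>g = Delta l powr \<beta>\<close> makes
  squared differences of order \<open>g * g\<close>, of which one \<open>g\<close> survives. The law
  of the level takes the square root of \<open>g\<close>, and the other square root makes the series
  over levels converge. This law is fixed before the test function, whose bound and Lipschitz
  constant enter only a multiplicative constant.

  A separate difficulty is measurability: meeting times are random variables only if the event that
  two coordinates agree is measurable, and the initial law of an increment chain is known only
  through its image measures.\<close>

text \<open>\<open>distr\<close> is the zero measure unless the set function on preimages is
  countably additive. Nonzero total mass therefore forces the usual image formula, without
  measurability of \<open>f\<close>.\<close>

lemma emeasure_distr_nonzero:
  assumes nz: "emeasure (distr N S f) (space S) \<noteq> 0" and A: "A \<in> sets S"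
  shows "emeasure (distr N S f) A = emeasure N (f -` A \<inter> space N)"
proof -
  have eq: "emeasure (distr N S f) = (\<lambda>B. if B \<in> sigma_sets (space S) (sets S)
      \<and> measure_space (space S) (sigma_sets (space S) (sets S)) (\<lambda>A. emeasure N (f -` A \<inter> space N))
      then emeasure N (f -` B \<inter> space N) else 0)"
    unfolding distr_def by (rule emeasure_measure_of_conv)
  then have "measure_space (space S) (sigma_sets (space S) (sets S)) (\<lambda>A. emeasure N (f -` A \<inter> space N))"
    using nz by (auto split: if_splits)
  then show ?thesis
    using A by (simp add: eq)
qed

section \<open>Iterated kernels applied to an initial law\<close>

lemma measurable_kpow:
  assumes K: "K \<in> Mx \<rightarrow>\<^sub>M prob_algebra Mx"
  shows "kpow Mx K n \<in> Mx \<rightarrow>\<^sub>M prob_algebra Mx"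
proof (induction n)
  case 0
  show ?case
    using measurable_return_prob_space[of Mx] by (simp cong: measurable_cong)
next
  case (Suc n)
  show ?case
    using measurable_bind_prob_space[OF Suc K] by (simp cong: measurable_cong)
qed

lemma bind_kpow_Suc:
  assumes K: "K \<in> Mx \<rightarrow>\<^sub>M prob_algebra Mx" and nu: "sets nu = sets Mx"
  shows "bind (bind nu (kpow Mx K n)) K = bind nu (kpow Mx K (Suc n))"
proof -
  have "kpow Mx K n \<in> nu \<rightarrow>\<^sub>M subprob_algebra Mx"
    using measurable_prob_algebraD[OF measurable_kpow[OF K]] nu by (simp cong: measurable_cong_sets)
  moreover have "kpow Mx K (Suc n) = (\<lambda>x. bind (kpow Mx K n x) K)"
    by (simp add: fun_eq_iff)
  ultimately show ?thesis
    using bind_assoc[of "kpow Mx K n" nu Mx K Mx] measurable_prob_algebraD[OF K] by simp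
qed

lemma bind_kpow_0:
  assumes nu: "sets nu = sets Mx"
  shows "bind nu (kpow Mx K 0) = nu"
proof -
  have "kpow Mx K 0 = return Mx" by (simp add: fun_eq_iff)
  then show ?thesis
    using nu by (simp add: bind_return'')
qed

lemma bind_kpow_1:
  assumes K: "K \<in> Mx \<rightarrow>\<^sub>M prob_algebra Mx" and nu: "sets nu = sets Mx"
  shows "bind nu (kpow Mx K 1) = bind nu K"
  using bind_kpow_Suc[OF K nu, of 0] unfolding bind_kpow_0[OF nu] by simp

section \<open>One-time laws and marginal laws of a chain\<close>

text \<open>The law of the length-one path is a probability measure, so the image of
  \<open>init\<close> has nonzero mass and can be evaluated on preimages. The intersection with
  \<open>space init\<close> stays because \<open>markov_chain\<close> does not relate the space of
  \<open>init\<close> to that of \<open>S\<close> directly.\<close>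

lemma markov_chain_init:
  assumes mc: "markov_chain M S init Kc Y" and M: "prob_space M" and A: "A \<in> sets S"
  shows "emeasure M (Y 0 -` A \<inter> space M) = emeasure init (A \<inter> space init)"
proof -
  interpret prob_space M by fact
  have Y: "Y 0 \<in> M \<rightarrow>\<^sub>M S"
   and eq: "distr M (PiM {0} (\<lambda>_. S)) (\<lambda>\<omega>. \<lambda>i\<in>{0}. Y i \<omega>)
      = distr init (PiM {0} (\<lambda>_. S)) (\<lambda>y. \<lambda>i\<in>{0}. y)"
    using mc[unfolded markov_chain_def] by (auto dest: spec[of _ "0::nat"] simp: atLeastAtMost_singleton)
  let ?P = "PiM {0::nat} (\<lambda>_. S)"
  have YP: "(\<lambda>\<omega>. \<lambda>i\<in>{0}. Y i \<omega>) \<in> M \<rightarrow>\<^sub>M ?P"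
    using Y by (intro measurable_restrict) auto
  interpret D: prob_space "distr M ?P (\<lambda>\<omega>. \<lambda>i\<in>{0}. Y i \<omega>)"
    by (rule prob_space_distr[OF YP])
  have nz: "emeasure (distr init ?P (\<lambda>y. \<lambda>i\<in>{0}. y)) (space ?P) \<noteq> 0"
    using D.emeasure_space_1 unfolding eq by simp
  define B where "B = (\<lambda>h. h (0::nat)) -` A \<inter> space ?P"
  have B: "B \<in> sets ?P"
    unfolding B_def using A by (intro measurable_sets[OF measurable_component_singleton]) auto
  have AS: "A \<subseteq> space S" using sets.sets_into_space[OF A] .
  have "(\<lambda>\<omega>. \<lambda>i\<in>{0}. Y i \<omega>) -` B \<inter> space M = Y 0 -` A \<inter> space M"
    using measurable_space[OF YP] by (auto simp: B_def)
  then have "emeasure M (Y 0 -` A \<inter> space M) = emeasure (distr M ?P (\<lambda>\<omega>. \<lambda>i\<in>{0}. Y i \<omega>)) B"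
    using emeasure_distr[OF YP B] by simp
  also have "\<dots> = emeasure init ((\<lambda>y. \<lambda>i\<in>{0::nat}. y) -` B \<inter> space init)"
    unfolding eq by (rule emeasure_distr_nonzero[OF nz B])
  also have "(\<lambda>y. \<lambda>i\<in>{0::nat}. y) -` B \<inter> space init = A \<inter> space init"
    using AS by (auto simp: B_def space_PiM PiE_def extensional_def)
  finally show ?thesis .
qed

text \<open>The \<open>\<sigma>\<close>-algebra of \<open>init\<close> is unspecified, so \<open>f\<close> need not be measurable on it; that the
  image measure has total mass one is enough.\<close>
lemma markov_chain_init_marginal:
  assumes mc: "markov_chain M S init Kc Y" and M: "prob_space M"
    and f: "f \<in> S \<rightarrow>\<^sub>M T" and sp: "space S = UNIV"
    and nz: "prob_space (distr init T f)"
  shows "distr M T (\<lambda>\<omega>. f (Y 0 \<omega>)) = distr init T f"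
proof (rule measure_eqI)
  have Y: "Y 0 \<in> M \<rightarrow>\<^sub>M S" using mc by (auto simp: markov_chain_def)
  have fY: "(\<lambda>\<omega>. f (Y 0 \<omega>)) \<in> M \<rightarrow>\<^sub>M T" using measurable_compose[OF Y f] .
  have ne: "emeasure (distr init T f) (space T) \<noteq> 0"
    using prob_space.emeasure_space_1[OF nz] by simp
  fix A assume "A \<in> sets (distr M T (\<lambda>\<omega>. f (Y 0 \<omega>)))"
  then have A: "A \<in> sets T" by simp
  have fA: "f -` A \<in> sets S" using measurable_sets[OF f A] sp by simp
  have "emeasure (distr M T (\<lambda>\<omega>. f (Y 0 \<omega>))) A = emeasure M (Y 0 -` (f -` A) \<inter> space M)"
    using emeasure_distr[OF fY A] by (simp add: vimage_def)
  also have "\<dots> = emeasure init (f -` A \<inter> space init)"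
    by (rule markov_chain_init[OF mc M fA])
  also have "\<dots> = emeasure (distr init T f) A"
    by (rule emeasure_distr_nonzero[OF ne A, symmetric])
  finally show "emeasure (distr M T (\<lambda>\<omega>. f (Y 0 \<omega>))) A = emeasure (distr init T f) A" .
qed simp

text \<open>Project the path law to its last coordinate: appending \<open>y\<close> to
  \<open>h\<close> and reading coordinate \<open>Suc n\<close> returns \<open>y\<close>, so the
  inner law collapses to \<open>Kc (h n)\<close>, which depends on the path only through its
  previous state.\<close>

lemma markov_chain_step:
  assumes mc: "markov_chain M S init Kc Y" and M: "prob_space M"
    and Kc: "Kc \<in> S \<rightarrow>\<^sub>M prob_algebra S"
  shows "distr M S (Y (Suc n)) = bind (distr M S (Y n)) Kc"
proof -
  interpret prob_space M by fact
  have Y: "\<And>n. Y n \<in> M \<rightarrow>\<^sub>M S"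
   and eq: "\<And>n. distr M (PiM {0..n} (\<lambda>_. S)) (\<lambda>\<omega>. \<lambda>i\<in>{0..n}. Y i \<omega>) = chain_fdd S init Kc n"
    using mc by (auto simp: markov_chain_def)
  let ?P = "\<lambda>n. PiM {0..n::nat} (\<lambda>_. S)"
  have YP: "(\<lambda>\<omega>. \<lambda>i\<in>{0..n}. Y i \<omega>) \<in> M \<rightarrow>\<^sub>M ?P n" for n
    using Y by (intro measurable_restrict) auto
  have law: "distr M S (Y n) = distr (chain_fdd S init Kc n) S (\<lambda>h. h n)" for n
    unfolding eq[symmetric]
    by (subst distr_distr) (auto simp: comp_def intro!: YP)
  have setsF: "sets (chain_fdd S init Kc n) = sets (?P n)" for n
    unfolding eq[symmetric] by simp
  have spF: "space (chain_fdd S init Kc n) = space (?P n)" for n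
    using setsF by (rule sets_eq_imp_space_eq)
  have neF: "space (chain_fdd S init Kc n) \<noteq> {}" for n
    unfolding eq[symmetric] using measurable_space[OF YP[of n]] not_empty by (metis ex_in_conv space_distr)
  have ins: "insert (Suc n) {0..n} = {0..Suc n}" by auto
  have Kn: "(\<lambda>h. Kc (h n)) \<in> ?P n \<rightarrow>\<^sub>M subprob_algebra S"
    by (rule measurable_compose[of "\<lambda>h. h n" _ S, OF _ measurable_prob_algebraD[OF Kc]]) simp
  have upd: "(\<lambda>(h, y). h(Suc n := y)) \<in> ?P n \<Otimes>\<^sub>M S \<rightarrow>\<^sub>M ?P (Suc n)"
    using measurable_add_dim[of "Suc n" "{0..n}" "\<lambda>_. S"] unfolding ins .
  have N: "(\<lambda>h. distr (Kc (h n)) (?P (Suc n)) (\<lambda>y. h(Suc n := y)))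
      \<in> chain_fdd S init Kc n \<rightarrow>\<^sub>M subprob_algebra (?P (Suc n))"
    unfolding measurable_cong_sets[OF setsF refl]
    by (rule measurable_distr2[OF _ Kn]) (use upd in simp)
  have "distr M S (Y (Suc n)) = bind (chain_fdd S init Kc n)
      (\<lambda>h. distr (distr (Kc (h n)) (?P (Suc n)) (\<lambda>y. h(Suc n := y))) S (\<lambda>h. h (Suc n)))"
    unfolding law chain_fdd.simps
    by (rule distr_bind[OF N neF]) auto
  also have "\<dots> = bind (chain_fdd S init Kc n) (\<lambda>h. Kc (h n))"
  proof (rule bind_cong[OF refl])
    fix h assume h: "h \<in> space (chain_fdd S init Kc n)"
    then have h: "h \<in> space (?P n)" by (simp add: spF)
    then have hn: "h n \<in> space S" by (auto simp: space_PiM)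
    have sK: "sets (Kc (h n)) = sets S"
      using measurable_space[OF Kc hn] by (simp add: space_prob_algebra)
    have "(\<lambda>y. h(Suc n := y)) \<in> S \<rightarrow>\<^sub>M ?P (Suc n)"
      using measurable_compose[OF measurable_Pair1'[OF h] upd] by simp
    then have "(\<lambda>y. h(Suc n := y)) \<in> Kc (h n) \<rightarrow>\<^sub>M ?P (Suc n)"
      unfolding measurable_cong_sets[OF sK refl] .
    then have "distr (distr (Kc (h n)) (?P (Suc n)) (\<lambda>y. h(Suc n := y))) S (\<lambda>h. h (Suc n))
        = distr (Kc (h n)) S (\<lambda>y. y)"
      by (subst distr_distr) (auto simp: comp_def)
    also have "\<dots> = Kc (h n)" using distr_id2[OF sK[symmetric]] by (simp add: id_def)
    finally show "distr (distr (Kc (h n)) (?P (Suc n)) (\<lambda>y. h(Suc n := y))) S (\<lambda>h. h (Suc n)) = Kc (h n)" .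
  qed
  also have "\<dots> = bind (distr (chain_fdd S init Kc n) S (\<lambda>h. h n)) Kc"
    by (rule bind_distr[symmetric, OF _ measurable_prob_algebraD[OF Kc] neF])
      (simp add: measurable_cong_sets[OF setsF refl])
  also have "\<dots> = bind (distr M S (Y n)) Kc" unfolding law ..
  finally show ?thesis .
qed

text \<open>The coordinate \<open>f\<close> evolves autonomously, since the image of
  \<open>Kc z\<close> under \<open>f\<close> depends on \<open>z\<close> only through
  \<open>f z\<close>. The offset \<open>j\<close> serves both members of a pair:
  \<open>j = 1\<close> for the one that starts a step ahead, \<open>j = 0\<close> for the
  other.\<close>

lemma markov_chain_marginal_law:
  assumes mc: "markov_chain M S init Kc Y" and M: "prob_space M"
    and Kc: "Kc \<in> S \<rightarrow>\<^sub>M prob_algebra S" and K: "K \<in> Mx \<rightarrow>\<^sub>M prob_algebra Mx"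
    and f: "f \<in> S \<rightarrow>\<^sub>M Mx" and sp: "space S = UNIV"
    and marg: "\<And>z. distr (Kc z) Mx f = K (f z)"
    and nu: "sets nu = sets Mx"
    and init: "distr M Mx (\<lambda>\<omega>. f (Y 0 \<omega>)) = bind nu (kpow Mx K j)"
  shows "distr M Mx (\<lambda>\<omega>. f (Y n \<omega>)) = bind nu (kpow Mx K (j + n))"
proof (induction n)
  case 0
  show ?case using init by simp
next
  case (Suc n)
  interpret prob_space M by fact
  have Y: "\<And>n. Y n \<in> M \<rightarrow>\<^sub>M S" using mc by (auto simp: markov_chain_def)
  have Kc': "Kc \<in> distr M S (Y n) \<rightarrow>\<^sub>M subprob_algebra S"
    using measurable_prob_algebraD[OF Kc] by simp
  have ne: "space (distr M S (Y n)) \<noteq> {}" using sp by simp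
  have "distr M Mx (\<lambda>\<omega>. f (Y (Suc n) \<omega>)) = distr (distr M S (Y (Suc n))) Mx f"
    using distr_distr[OF f Y[of "Suc n"]] by (simp add: comp_def)
  also have "\<dots> = distr (bind (distr M S (Y n)) Kc) Mx f"
    by (simp add: markov_chain_step[OF mc M Kc])
  also have "\<dots> = bind (distr M S (Y n)) (\<lambda>z. K (f z))"
    unfolding distr_bind[OF Kc' ne f] marg ..
  also have "\<dots> = bind (distr (distr M S (Y n)) Mx f) K"
    by (rule bind_distr[symmetric, OF _ measurable_prob_algebraD[OF K] ne]) (use f in simp)
  also have "distr (distr M S (Y n)) Mx f = bind nu (kpow Mx K (j + n))"
    using distr_distr[OF f Y[of n]] Suc by (simp add: comp_def)
  finally show ?case using bind_kpow_Suc[OF K nu] by (simp del: kpow.simps)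
qed

section \<open>The lagged initial law of a pair\<close>

lemma prob_space_nucheck:
  assumes K: "K \<in> Mx \<rightarrow>\<^sub>M prob_algebra Mx"
    and nut: "prob_space nut" "sets nut = sets (Mx \<Otimes>\<^sub>M Mx)"
  shows "prob_space (nucheck Mx K nut)" and "sets (nucheck Mx K nut) = sets (Mx \<Otimes>\<^sub>M Mx)"
proof -
  have eq: "nucheck Mx K nut = bind nut (\<lambda>p. distr (K (fst p)) (Mx \<Otimes>\<^sub>M Mx) (\<lambda>x. (x, snd p)))"
    unfolding nucheck_def by (simp add: case_prod_unfold)
  have N: "(\<lambda>p. distr (K (fst p)) (Mx \<Otimes>\<^sub>M Mx) (\<lambda>x. (x, snd p))) \<in> Mx \<Otimes>\<^sub>M Mx \<rightarrow>\<^sub>M prob_algebra (Mx \<Otimes>\<^sub>M Mx)"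
    by (rule measurable_distr_prob_space2[OF measurable_compose[OF measurable_fst K]]) measurable
  have nut': "nut \<in> space (prob_algebra (Mx \<Otimes>\<^sub>M Mx))"
    using nut by (simp add: space_prob_algebra)
  show "prob_space (nucheck Mx K nut)" "sets (nucheck Mx K nut) = sets (Mx \<Otimes>\<^sub>M Mx)"
    unfolding eq by (rule prob_space_bind'[OF nut' N], rule sets_bind'[OF nut' N])
qed

text \<open>This is the source of the one-step lag between the two chains of a pair: the first
  coordinate has already made one move with \<open>K\<close>, the second has not moved.\<close>

lemma nucheck_marginals:
  assumes K: "K \<in> Mx \<rightarrow>\<^sub>M prob_algebra Mx" and sp: "space Mx = UNIV"
    and nut: "sets nut = sets (Mx \<Otimes>\<^sub>M Mx)"
  shows "distr (nucheck Mx K nut) Mx fst = bind (distr nut Mx fst) K"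
    and "distr (nucheck Mx K nut) Mx snd = distr nut Mx snd"
proof -
  have Kfst: "(\<lambda>p. K (fst p)) \<in> nut \<rightarrow>\<^sub>M subprob_algebra Mx"
    unfolding measurable_cong_sets[OF nut refl]
    by (rule measurable_compose[OF measurable_fst measurable_prob_algebraD[OF K]])
  have mf: "fst \<in> nut \<rightarrow>\<^sub>M Mx" "snd \<in> nut \<rightarrow>\<^sub>M Mx"
    unfolding measurable_cong_sets[OF nut refl] by auto
  have N: "(\<lambda>p. distr (K (fst p)) (Mx \<Otimes>\<^sub>M Mx) (\<lambda>x. (x, snd p))) \<in> nut \<rightarrow>\<^sub>M subprob_algebra (Mx \<Otimes>\<^sub>M Mx)"
    by (rule measurable_distr2[OF _ Kfst]) (use mf in measurable)
  have ne: "space nut \<noteq> {}"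
    using sets_eq_imp_space_eq[OF nut] sp by (simp add: space_pair_measure)
  have eq: "nucheck Mx K nut = bind nut (\<lambda>p. distr (K (fst p)) (Mx \<Otimes>\<^sub>M Mx) (\<lambda>x. (x, snd p)))"
    unfolding nucheck_def by (simp add: case_prod_unfold)
  have sK: "sets (K x) = sets Mx" and pK: "prob_space (K x)" for x
    using measurable_space[OF K, of x] sp by (simp_all add: space_prob_algebra)
  have pr: "(\<lambda>x. (x, w)) \<in> K y \<rightarrow>\<^sub>M Mx \<Otimes>\<^sub>M Mx" for w y
    unfolding measurable_cong_sets[OF sK refl] by (rule measurable_Pair) (use sp in auto)
  have "distr (nucheck Mx K nut) Mx fst = bind nut (\<lambda>p. K (fst p))"
    unfolding eq distr_bind[OF N ne measurable_fst] distr_distr[OF measurable_fst pr]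
    by (simp add: comp_def distr_id2 sK)
  also have "\<dots> = bind (distr nut Mx fst) K"
    by (rule bind_distr[symmetric, OF mf(1) measurable_prob_algebraD[OF K] ne])
  finally show "distr (nucheck Mx K nut) Mx fst = bind (distr nut Mx fst) K" .
  have "distr (nucheck Mx K nut) Mx snd = bind nut (\<lambda>p. return Mx (snd p))"
    unfolding eq distr_bind[OF N ne measurable_snd] distr_distr[OF measurable_snd pr]
    using sp by (simp add: comp_def prob_space.distr_const[OF pK])
  also have "\<dots> = distr nut Mx snd"
    by (rule bind_return_distr'[OF ne mf(2)])
  finally show "distr (nucheck Mx K nut) Mx snd = distr nut Mx snd" .
qed

section \<open>Total variation and expectations\<close>

lemma tv_dist_upper:
  assumes mu: "prob_space mu" and nu: "prob_space nu" and A: "A \<in> sets Mx"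
  shows "\<bar>measure mu A - measure nu A\<bar> \<le> tv_dist Mx mu nu"
  unfolding tv_dist_def
proof (rule cSUP_upper[OF A], rule bdd_aboveI2)
  fix A
  have "0 \<le> measure mu A" "0 \<le> measure nu A" "measure mu A \<le> 1" "measure nu A \<le> 1"
    using prob_space.prob_le_1[OF mu] prob_space.prob_le_1[OF nu] by auto
  then show "\<bar>measure mu A - measure nu A\<bar> \<le> 1" by linarith
qed

text \<open>The sum counts the \<open>i\<close> with \<open>i \<le> t * N\<close>, so it is the
  floor \<open>m\<close> of \<open>t * N\<close>, and \<open>t\<close> differs from
  \<open>m / N\<close> by less than one grid step.\<close>

lemma sum_indicator_floor:
  fixes t :: real
  assumes N: "N > 0" and t: "0 \<le> t" "t \<le> 1"
  shows "\<bar>t - (\<Sum>i=1..N. (if real i / real N \<le> t then 1 else 0)) / real N\<bar> \<le> 1 / real N"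
proof -
  define m where "m = nat \<lfloor>t * N\<rfloor>"
  have m: "real m \<le> t * N" "t * N < real m + 1"
    using t N unfolding m_def by (simp_all add: of_nat_nat)
  have mN: "m \<le> N"
  proof -
    have "t * N \<le> 1 * real N" using t by (intro mult_right_mono) auto
    then have "real m \<le> real N" using m by linarith
    then show ?thesis by simp
  qed
  have "(\<Sum>i=1..N. (if real i / real N \<le> t then 1 else 0::real)) = real (card {i\<in>{1..N}. real i / real N \<le> t})"
    by (simp add: sum.If_cases Int_def)
  also have "{i\<in>{1..N}. real i / real N \<le> t} = {1..m}"
  proof -
    have iff: "real i / real N \<le> t \<longleftrightarrow> i \<le> m" for i
    proof -
      have "real i / real N \<le> t \<longleftrightarrow> real i \<le> t * N" using N by (simp add: field_simps)
      also have "\<dots> \<longleftrightarrow> i \<le> m" using m by linarith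
      finally show ?thesis .
    qed
    show ?thesis unfolding iff using mN by auto
  qed
  finally have eq: "(\<Sum>i=1..N. (if real i / real N \<le> t then 1 else 0::real)) = real m" by simp
  have "t - real m / real N = (t * N - m) / N" using N by (simp add: field_simps)
  moreover have "0 \<le> (t * N - m) / N" "(t * N - m) / N \<le> 1 / N"
    using m by (intro divide_nonneg_nonneg divide_right_mono; simp)+
  ultimately show ?thesis unfolding eq by linarith
qed

text \<open>A function with values in \<open>[0,1]\<close> is within \<open>1/N\<close> of the average of the indicators of its
  superlevel sets at heights \<open>i/N\<close>.\<close>
lemma integral_diff_le_tv_unit:
  assumes mu: "prob_space mu" "sets mu = sets Mx" and nu: "prob_space nu" "sets nu = sets Mx"
    and f: "f \<in> borel_measurable Mx" and f01: "\<And>x. 0 \<le> f x \<and> f x \<le> (1::real)"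
  shows "\<bar>(\<integral>x. f x \<partial>mu) - (\<integral>x. f x \<partial>nu)\<bar> \<le> tv_dist Mx mu nu"
proof -
  let ?T = "tv_dist Mx mu nu"
  have approx: "\<bar>(\<integral>x. f x \<partial>rho) - (\<Sum>i=1..N. measure rho {x\<in>space Mx. real i / real N \<le> f x}) / N\<bar> \<le> 1 / real N"
    if rho: "prob_space rho" "sets rho = sets Mx" and N: "N > 0" for rho :: "'a measure" and N :: nat
  proof -
    interpret prob_space rho by fact
    have sp: "space rho = space Mx" using rho(2) by (rule sets_eq_imp_space_eq)
    have fm[measurable]: "f \<in> borel_measurable rho" using f rho(2) by (simp cong: measurable_cong_sets)
    have if1: "integrable rho f" by (rule integrable_const_bound[of _ 1]) (use f01 in auto)
    let ?h = "\<lambda>i x. (if real i / real N \<le> f x then 1 else 0::real)"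
    have h: "integrable rho (?h i)" for i by (rule integrable_const_bound[of _ 1]) auto
    have hi: "(\<integral>x. ?h i x \<partial>rho) = measure rho {x\<in>space Mx. real i / real N \<le> f x}" for i
    proof -
      have "(\<integral>x. ?h i x \<partial>rho) = (\<integral>x. indicator {x\<in>space Mx. real i / real N \<le> f x} x \<partial>rho)"
        by (intro Bochner_Integration.integral_cong) (auto simp: sp)
      also have "{x\<in>space Mx. real i / real N \<le> f x} \<inter> space rho = {x\<in>space Mx. real i / real N \<le> f x}"
        by (auto simp: sp)
      then have "(\<integral>x. indicator {x\<in>space Mx. real i / real N \<le> f x} x \<partial>rho) = measure rho {x\<in>space Mx. real i / real N \<le> f x}"
        by simp
      finally show ?thesis .
    qed
    have "(\<integral>x. f x \<partial>rho) - (\<Sum>i=1..N. measure rho {x\<in>space Mx. real i / real N \<le> f x}) / N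
        = (\<integral>x. f x - (\<Sum>i=1..N. ?h i x) / N \<partial>rho)"
      using if1 h by (simp add: hi)
    also have "\<bar>\<dots>\<bar> \<le> (\<integral>x. \<bar>f x - (\<Sum>i=1..N. ?h i x) / N\<bar> \<partial>rho)"
      by (rule integral_abs_bound)
    also have "\<dots> \<le> (\<integral>x. 1 / real N \<partial>rho)"
      by (rule integral_mono) (use if1 h f01 sum_indicator_floor[OF N] in auto)
    also have "\<dots> = 1 / N" by (simp add: prob_space)
    finally show ?thesis .
  qed
  \<comment> \<open>Averages of indicators integrate to averages of measures of superlevel sets,
    each of which changes by at most \<open>?T\<close> between the two measures. The discretisation
    error, \<open>1 / N\<close> for each measure, disappears as \<open>N\<close> grows.\<close>
  have bd: "\<bar>(\<integral>x. f x \<partial>mu) - (\<integral>x. f x \<partial>nu)\<bar> \<le> ?T + 2 / real N" if N: "N > 0" for N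
  proof -
    let ?A = "\<lambda>i. {x\<in>space Mx. real i / real N \<le> f x}"
    have A: "?A i \<in> sets Mx" for i using f by measurable
    have "\<bar>(\<Sum>i=1..N. measure mu (?A i)) / N - (\<Sum>i=1..N. measure nu (?A i)) / N\<bar>
        = \<bar>\<Sum>i=1..N. measure mu (?A i) - measure nu (?A i)\<bar> / N"
      by (simp add: sum_subtractf diff_divide_distrib[symmetric])
    also have "\<dots> \<le> (\<Sum>i=1..N. \<bar>measure mu (?A i) - measure nu (?A i)\<bar>) / N"
      by (intro divide_right_mono sum_abs) auto
    also have "\<dots> \<le> (\<Sum>i=1..N. ?T) / N"
      by (intro divide_right_mono sum_mono tv_dist_upper mu nu A) auto
    also have "\<dots> = ?T" using N by simp
    finally have 1: "\<bar>(\<Sum>i=1..N. measure mu (?A i)) / N - (\<Sum>i=1..N. measure nu (?A i)) / N\<bar> \<le> ?T" .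
    have "2 / real N = 1 / real N + 1 / real N" by simp
    then show ?thesis
      using 1 approx[OF mu N] approx[OF nu N] by linarith
  qed
  have "(\<lambda>N. ?T + 2 / real (Suc N)) \<longlonglongrightarrow> ?T + 0"
    by (intro tendsto_add tendsto_const LIMSEQ_Suc[OF lim_const_over_n])
  then show ?thesis
    using bd[of "Suc _"] by (intro LIMSEQ_le_const[of "\<lambda>N. ?T + 2 / real (Suc N)" ?T]) (auto simp del: of_nat_Suc)
qed

text \<open>The affine map from \<open>[-B, B]\<close> onto \<open>[0, 1]\<close> reduces to the
  unit case; undoing it costs the factor \<open>2 * B\<close>.\<close>

lemma integral_diff_le_tv:
  assumes mu: "prob_space mu" "sets mu = sets Mx" and nu: "prob_space nu" "sets nu = sets Mx"
    and f: "f \<in> borel_measurable Mx" and fB: "\<And>x. \<bar>f x\<bar> \<le> B" and B: "B > 0"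
  shows "\<bar>(\<integral>x. f x \<partial>mu) - (\<integral>x. f x \<partial>nu)\<bar> \<le> 2 * B * tv_dist Mx mu nu"
proof -
  define g where "g x = (f x + B) / (2 * B)" for x
  have g: "g \<in> borel_measurable Mx" unfolding g_def using f by measurable
  have g01: "0 \<le> g x \<and> g x \<le> 1" for x
    using fB[of x] B by (auto simp: g_def field_simps abs_le_iff)
  have int: "(\<integral>x. g x \<partial>rho) = ((\<integral>x. f x \<partial>rho) + B) / (2 * B)"
    if rho: "prob_space rho" "sets rho = sets Mx" for rho
  proof -
    interpret prob_space rho by fact
    have "f \<in> borel_measurable rho" using f rho(2) by (simp cong: measurable_cong_sets)
    then have "integrable rho f"
      by (intro integrable_const_bound[of _ B]) (use fB in auto)
    then show ?thesis unfolding g_def by (simp add: prob_space)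
  qed
  have "\<bar>((\<integral>x. f x \<partial>mu) - (\<integral>x. f x \<partial>nu)) / (2 * B)\<bar> \<le> tv_dist Mx mu nu"
    using integral_diff_le_tv_unit[OF mu nu g g01] unfolding int[OF mu] int[OF nu]
    by (simp add: diff_divide_distrib[symmetric])
  then show ?thesis using B by (simp add: field_simps)
qed

text \<open>The ergodic bound is uniform in the starting point, so it survives averaging over the
  arbitrary initial law \<open>nu\<close>.\<close>

lemma integral_kpow_tendsto:
  assumes K: "K \<in> Mx \<rightarrow>\<^sub>M prob_algebra Mx" and sp: "space Mx = UNIV"
    and nu: "prob_space nu" "sets nu = sets Mx" and mu: "prob_space mu" "sets mu = sets Mx"
    and f: "f \<in> borel_measurable Mx" and fB: "\<And>x. \<bar>f x\<bar> \<le> (B::real)"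
    and r: "0 < r" "r < 1"
    and erg: "\<And>x n. n \<ge> 1 \<Longrightarrow> tv_dist Mx (kpow Mx K n x) mu \<le> C * r ^ n"
  shows "(\<lambda>n. \<integral>x. f x \<partial>(bind nu (kpow Mx K n))) \<longlonglongrightarrow> (\<integral>x. f x \<partial>mu)"
proof -
  interpret prob_space nu by fact
  \<comment> \<open>The bound \<open>B\<close> may be 0, whereas rescaling to the unit interval
    divides by it.\<close>
  define B' where "B' = max B 1"
  have B': "B' > 0" "\<And>x. \<bar>f x\<bar> \<le> B'" using fB by (auto simp: B'_def le_max_iff_disj)
  have Kn: "kpow Mx K n \<in> nu \<rightarrow>\<^sub>M subprob_algebra Mx" for n
    using measurable_prob_algebraD[OF measurable_kpow[OF K]] nu by (simp cong: measurable_cong_sets)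
  have pK: "prob_space (kpow Mx K n x)" and sK: "sets (kpow Mx K n x) = sets Mx" for n x
    using measurable_space[OF measurable_kpow[OF K], of x n] sp by (simp_all add: space_prob_algebra)
  have eq: "(\<integral>x. f x \<partial>(bind nu (kpow Mx K n))) = (\<integral>x. (\<integral>y. f y \<partial>kpow Mx K n x) \<partial>nu)" for n
    by (rule integral_bind[OF f B'(2) Kn finite_measure_axioms, where B'=1])
      (simp add: prob_space.emeasure_space_1[OF pK])
  have bound: "\<bar>(\<integral>x. f x \<partial>(bind nu (kpow Mx K n))) - (\<integral>x. f x \<partial>mu)\<bar> \<le> 2 * B' * (C * r ^ n)" if n: "n \<ge> 1" for n
  proof -
    have b: "\<bar>(\<integral>y. f y \<partial>kpow Mx K n x) - (\<integral>x. f x \<partial>mu)\<bar> \<le> 2 * B' * (C * r ^ n)" for x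
      using integral_diff_le_tv[OF pK sK mu f B'(2,1), of n x] B'(1)
        mult_left_mono[OF erg[OF n, of x], of "2 * B'"] by linarith
    have m: "(\<lambda>x. \<integral>y. f y \<partial>kpow Mx K n x) \<in> borel_measurable nu"
      by (rule measurable_compose[OF Kn integral_measurable_subprob_algebra[OF f]])
    have i: "integrable nu (\<lambda>x. \<integral>y. f y \<partial>kpow Mx K n x)"
    proof (rule integrable_const_bound[OF _ m, of "\<bar>\<integral>x. f x \<partial>mu\<bar> + 2 * B' * (C * r ^ n)"], rule AE_I2)
      fix x show "norm (\<integral>y. f y \<partial>kpow Mx K n x) \<le> \<bar>\<integral>x. f x \<partial>mu\<bar> + 2 * B' * (C * r ^ n)"
        using b[of x] by simp
    qed
    have "(\<integral>x. f x \<partial>(bind nu (kpow Mx K n))) - (\<integral>x. f x \<partial>mu)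
        = (\<integral>x. (\<integral>y. f y \<partial>kpow Mx K n x) - (\<integral>x. f x \<partial>mu) \<partial>nu)"
      unfolding eq using i by (simp add: prob_space)
    also have "\<bar>\<dots>\<bar> \<le> (\<integral>x. \<bar>(\<integral>y. f y \<partial>kpow Mx K n x) - (\<integral>x. f x \<partial>mu)\<bar> \<partial>nu)"
      by (rule integral_abs_bound)
    also have "\<dots> \<le> (\<integral>x. 2 * B' * (C * r ^ n) \<partial>nu)"
      by (rule integral_mono) (use i b in auto)
    finally show ?thesis by (simp add: prob_space)
  qed
  have lim: "(\<lambda>n. 2 * B' * (C * r ^ n)) \<longlonglongrightarrow> 2 * B' * (C * 0)"
    using r by (intro tendsto_intros LIMSEQ_realpow_zero) auto
  have "(\<lambda>n. (\<integral>x. f x \<partial>(bind nu (kpow Mx K n))) - (\<integral>x. f x \<partial>mu)) \<longlonglongrightarrow> 0"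
  proof (rule Lim_null_comparison)
    show "\<forall>\<^sub>F n in sequentially. norm ((\<integral>x. f x \<partial>(bind nu (kpow Mx K n))) - (\<integral>x. f x \<partial>mu)) \<le> 2 * B' * (C * r ^ n)"
      unfolding real_norm_def using bound by (rule eventually_sequentiallyI[of 1])
    show "(\<lambda>n. 2 * B' * (C * r ^ n)) \<longlonglongrightarrow> 0" using lim by simp
  qed
  then show ?thesis by (rule LIM_zero_cancel)
qed

section \<open>The coupled estimator\<close>

text \<open>Splitting \<open>t n\<close> as \<open>sqrt (r ^ n)\<close> times a remainder leaves a
  geometric sum as the other factor, bounded by \<open>1 / (1 - r)\<close> uniformly in
  \<open>N\<close>; this uniformity permits a random number of terms.\<close>

lemma weighted_Cauchy_Schwarz:
  fixes t :: "nat \<Rightarrow> real"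
  assumes r: "0 < r" "r < 1"
  shows "(\<Sum>n<N. t n)\<^sup>2 \<le> (\<Sum>n<N. 1 / (1 - r) * (t n)\<^sup>2 / r ^ n)"
proof -
  have "(\<Sum>n<N. t n)\<^sup>2 = (\<Sum>n<N. sqrt (r ^ n) * (t n / sqrt (r ^ n)))\<^sup>2"
    using r by (intro arg_cong[where f="\<lambda>x. x\<^sup>2"] sum.cong) auto
  also have "\<dots> \<le> (\<Sum>n<N. (sqrt (r ^ n))\<^sup>2) * (\<Sum>n<N. (t n / sqrt (r ^ n))\<^sup>2)"
    by (rule Cauchy_Schwarz_ineq_sum)
  also have "\<dots> = (\<Sum>n<N. r ^ n) * (\<Sum>n<N. (t n)\<^sup>2 / r ^ n)"
    using r by (simp add: power_divide)
  also have "\<dots> \<le> 1 / (1 - r) * (\<Sum>n<N. (t n)\<^sup>2 / r ^ n)"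
  proof (rule mult_right_mono)
    have "(\<Sum>n<N. r ^ n) \<le> (\<Sum>n. r ^ n)"
      using r by (intro sum_le_suminf summable_geometric) auto
    then show "(\<Sum>n<N. r ^ n) \<le> 1 / (1 - r)"
      using r by (simp add: suminf_geometric)
  qed (use r in \<open>auto intro!: sum_nonneg\<close>)
  also have "\<dots> = (\<Sum>n<N. 1 / (1 - r) * (t n)\<^sup>2 / r ^ n)"
    by (simp add: sum_distrib_left)
  finally show ?thesis .
qed

text \<open>Almost every path has finitely many nonzero terms, so the weighted inequality applies
  pathwise with a random cut-off. Nonnegative integration exchanges sum and integral before anything
  is known about the limit, whose integrability is then read off from the finite bound.\<close>

lemma (in prob_space) second_moment_suminf:
  fixes D :: "nat \<Rightarrow> 'a \<Rightarrow> real"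
  assumes D[measurable]: "\<And>n. D n \<in> borel_measurable M"
    and b: "\<And>n \<omega>. \<omega> \<in> space M \<Longrightarrow> \<bar>D n \<omega>\<bar> \<le> b"
    and v: "\<And>n. (\<integral>\<omega>. (D n \<omega>)\<^sup>2 \<partial>M) \<le> v n"
    and r: "0 < r" "r < 1" and sm: "summable (\<lambda>n. v n / r ^ n)"
    and fin: "AE \<omega> in M. \<exists>N. \<forall>n\<ge>N. D n \<omega> = 0"
  shows "integrable M (\<lambda>\<omega>. (\<Sum>n. D n \<omega>)\<^sup>2)"
    and "(\<integral>\<omega>. (\<Sum>n. D n \<omega>)\<^sup>2 \<partial>M) \<le> 1 / (1 - r) * (\<Sum>n. v n / r ^ n)"
proof -
  have iD: "integrable M (\<lambda>\<omega>. (D n \<omega>)\<^sup>2)" for n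
  proof (rule integrable_const_bound[of _ "b\<^sup>2"], rule AE_I2)
    fix \<omega> assume "\<omega> \<in> space M"
    then show "norm ((D n \<omega>)\<^sup>2) \<le> b\<^sup>2"
      using power_mono[OF b[of \<omega> n] abs_ge_zero, of 2] by simp
  qed simp
  have v0: "0 \<le> v n" for n by (rule order_trans[OF Bochner_Integration.integral_nonneg v[of n]]) auto
  define T where "T = 1 / (1 - r) * (\<Sum>n. v n / r ^ n)"
  have T0: "0 \<le> T" unfolding T_def using r v0 sm by (intro mult_nonneg_nonneg suminf_nonneg) auto
  have "(\<integral>\<^sup>+\<omega>. ennreal ((\<Sum>n. D n \<omega>)\<^sup>2) \<partial>M)
      \<le> (\<integral>\<^sup>+\<omega>. (\<Sum>n. ennreal (1 / (1 - r) * (D n \<omega>)\<^sup>2 / r ^ n)) \<partial>M)"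
  proof (rule nn_integral_mono_AE, use fin in eventually_elim)
    fix \<omega> assume "\<exists>N. \<forall>n\<ge>N. D n \<omega> = 0"
    then obtain N where N: "\<forall>n\<ge>N. D n \<omega> = 0" by blast
    then have "(\<Sum>n. D n \<omega>) = (\<Sum>n<N. D n \<omega>)"
      by (intro suminf_finite) (auto simp: not_less)
    then have "ennreal ((\<Sum>n. D n \<omega>)\<^sup>2) \<le> ennreal (\<Sum>n<N. 1 / (1 - r) * (D n \<omega>)\<^sup>2 / r ^ n)"
      using weighted_Cauchy_Schwarz[OF r] by (simp add: ennreal_leI)
    also have "\<dots> = (\<Sum>n<N. ennreal (1 / (1 - r) * (D n \<omega>)\<^sup>2 / r ^ n))"
      using r by (intro sum_ennreal[symmetric]) auto
    also have "\<dots> \<le> (\<Sum>n. ennreal (1 / (1 - r) * (D n \<omega>)\<^sup>2 / r ^ n))"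
      by (intro sum_le_suminf) auto
    finally show "ennreal ((\<Sum>n. D n \<omega>)\<^sup>2) \<le> (\<Sum>n. ennreal (1 / (1 - r) * (D n \<omega>)\<^sup>2 / r ^ n))" .
  qed
  also have "\<dots> = (\<Sum>n. \<integral>\<^sup>+\<omega>. ennreal (1 / (1 - r) * (D n \<omega>)\<^sup>2 / r ^ n) \<partial>M)"
    by (intro nn_integral_suminf) auto
  also have "\<dots> \<le> (\<Sum>n. ennreal (1 / (1 - r) * (v n / r ^ n)))"
  proof (rule suminf_le)
    fix n
    have "(\<integral>\<^sup>+\<omega>. ennreal (1 / (1 - r) * (D n \<omega>)\<^sup>2 / r ^ n) \<partial>M)
        = ennreal (\<integral>\<omega>. 1 / (1 - r) * (D n \<omega>)\<^sup>2 / r ^ n \<partial>M)"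
      using r iD by (intro nn_integral_eq_integral) auto
    also have "(\<integral>\<omega>. 1 / (1 - r) * (D n \<omega>)\<^sup>2 / r ^ n \<partial>M) = 1 / (1 - r) * (\<integral>\<omega>. (D n \<omega>)\<^sup>2 \<partial>M) / r ^ n"
      by simp
    also have "ennreal \<dots> \<le> ennreal (1 / (1 - r) * (v n / r ^ n))"
      unfolding times_divide_eq_right[symmetric]
      using r v[of n] by (intro ennreal_leI mult_left_mono divide_right_mono) auto
    finally show "(\<integral>\<^sup>+\<omega>. ennreal (1 / (1 - r) * (D n \<omega>)\<^sup>2 / r ^ n) \<partial>M) \<le> ennreal (1 / (1 - r) * (v n / r ^ n))" .
  qed auto
  also have "\<dots> = ennreal T"
    unfolding T_def suminf_mult[OF sm, symmetric]
    using r v0 sm by (intro suminf_ennreal2 summable_mult) auto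
  finally have le: "(\<integral>\<^sup>+\<omega>. ennreal ((\<Sum>n. D n \<omega>)\<^sup>2) \<partial>M) \<le> ennreal T" .
  show int: "integrable M (\<lambda>\<omega>. (\<Sum>n. D n \<omega>)\<^sup>2)"
    by (rule integrableI_bounded) (use le in \<open>auto simp: less_top[symmetric] top_unique intro: le_less_trans\<close>)
  show "(\<integral>\<omega>. (\<Sum>n. D n \<omega>)\<^sup>2 \<partial>M) \<le> T"
    using le nn_integral_eq_integral[OF int] T0 by simp
qed

section \<open>Meeting times and the estimator as a series\<close>

lemma meet_eq_enat_iff:
  "meet x w = enat t \<longleftrightarrow> 1 \<le> t \<and> x t = w t \<and> (\<forall>n. 1 \<le> n \<and> n < t \<longrightarrow> x n \<noteq> w n)" (is "?l = ?r")
proof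
  assume ?l
  then have ex: "\<exists>n\<ge>1. x n = w n" by (rule contrapos_pp) (simp only: meet_def if_False, simp)
  with \<open>?l\<close> have t: "t = (LEAST n. 1 \<le> n \<and> x n = w n)" by (simp only: meet_def if_True enat.inject)
  from ex have "1 \<le> t \<and> x t = w t" unfolding t by (rule LeastI_ex)
  moreover have "x n \<noteq> w n" if "1 \<le> n" "n < t" for n
    using not_less_Least[of n "\<lambda>n. 1 \<le> n \<and> x n = w n"] that unfolding t by blast
  ultimately show ?r by blast
next
  assume r: ?r
  have "(LEAST n. 1 \<le> n \<and> x n = w n) = t"
  proof (rule Least_equality)
    show "1 \<le> t \<and> x t = w t" using r by blast
    show "t \<le> n" if "1 \<le> n \<and> x n = w n" for n
      using r that not_le by blast
  qed
  moreover have "\<exists>n\<ge>1. x n = w n" using r by blast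
  ultimately show ?l by (simp add: meet_def)
qed

lemma less_meet_iff: "enat n < meet x w \<longleftrightarrow> (\<forall>j\<in>{1..n}. x j \<noteq> w j)"
proof (cases "meet x w")
  case (enat t)
  then have "1 \<le> t \<and> x t = w t \<and> (\<forall>n. 1 \<le> n \<and> n < t \<longrightarrow> x n \<noteq> w n)"
    using meet_eq_enat_iff[of x w t] by simp
  then show ?thesis unfolding enat by (auto intro: leI simp: Ball_def)
next
  case infinity
  then show ?thesis by (auto simp: meet_def split: if_splits)
qed

text \<open>Measurability of the estimator is checked on this form: a countable sum over the
  possible meeting times, each summand having a deterministic range of times. The value 0 at
  infinity in \<open>est\<close> is the case where no summand is active.\<close>

lemma est_eq_suminf_meet:
  "est phi k x w = (\<Sum>t. if meet x w = enat t
     then phi (x k) + (\<Sum>n\<in>{k+1..<t}. phi (x n) - phi (w n)) else 0)"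
proof (cases "meet x w")
  case (enat t)
  have "(\<Sum>s. if meet x w = enat s then phi (x k) + (\<Sum>n\<in>{k+1..<s}. phi (x n) - phi (w n)) else 0)
     = (\<Sum>s\<in>{t}. if meet x w = enat s then phi (x k) + (\<Sum>n\<in>{k+1..<s}. phi (x n) - phi (w n)) else 0)"
    by (rule suminf_finite) (auto simp: enat)
  then show ?thesis by (simp add: est_def enat)
qed (simp add: est_def)

text \<open>The index is shifted by \<open>k\<close>, and the leading \<open>phi (x k)\<close>
  becomes the term at 0, so that the whole estimator is a single series with terms at deterministic
  times.\<close>

definition est_term :: "('a \<Rightarrow> real) \<Rightarrow> nat \<Rightarrow> (nat \<Rightarrow> 'a) \<Rightarrow> (nat \<Rightarrow> 'a) \<Rightarrow> nat \<Rightarrow> real" where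
  "est_term phi k x w n = phi (x (k + n)) - (if n = 0 then 0 else phi (w (k + n)))"

lemma est_eq_suminf_term:
  assumes t: "meet x w = enat t" and f: "\<And>n. t \<le> n \<Longrightarrow> x n = w n"
  shows "est phi k x w = (\<Sum>n. est_term phi k x w n)"
    and "\<forall>n\<ge>Suc t. est_term phi k x w n = 0"
proof -
  \<comment> \<open>Starting at \<open>Suc t\<close> excludes \<open>n = 0\<close>, whose term
    \<open>phi (x k)\<close> has nothing to cancel it even after the meeting.\<close>
  show z: "\<forall>n\<ge>Suc t. est_term phi k x w n = 0"
    using f by (auto simp: est_term_def)
  let ?g = "\<lambda>j. phi (x j) - phi (w j)"
  have "(\<Sum>n. est_term phi k x w n) = (\<Sum>n<Suc t. est_term phi k x w n)"
    using z by (intro suminf_finite) (auto simp: not_less)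
  also have "\<dots> = phi (x k) + (\<Sum>n<t. ?g (k + Suc n))"
    unfolding sum.lessThan_Suc_shift by (simp add: est_term_def)
  also have "(\<Sum>n<t. ?g (k + Suc n)) = (\<Sum>j\<in>{k+1..<k+1+t}. ?g j)"
    by (rule sum.reindex_bij_witness[of _ "\<lambda>j. j - (k + 1)" "\<lambda>n. k + Suc n"]) auto
  \<comment> \<open>The window of length \<open>t\<close> reaches at least to time \<open>t\<close>;
    the surplus indices lie after the meeting and contribute 0, also when
    \<open>t \<le> k + 1\<close> and the target sum is empty.\<close>
  also have "\<dots> = (\<Sum>j\<in>{k+1..<t}. ?g j)"
    using f by (intro sum.mono_neutral_right) auto
  finally show "est phi k x w = (\<Sum>n. est_term phi k x w n)"
    by (simp add: est_def t)
qed

text \<open>In a general measurable space the diagonal need not be measurable; here it is the zero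
  set of the jointly measurable metric.\<close>

lemma pred_eq_metric:
  assumes met: "measurable_bounded_metric Mx d"
    and X: "X \<in> N \<rightarrow>\<^sub>M Mx" and W: "W \<in> N \<rightarrow>\<^sub>M Mx"
  shows "Measurable.pred N (\<lambda>\<omega>. X \<omega> = W \<omega>)"
proof -
  have "(\<lambda>\<omega>. (\<lambda>(x, w). d x w) (X \<omega>, W \<omega>)) \<in> borel_measurable N"
    using met by (intro measurable_compose[OF measurable_Pair[OF X W]]) (auto simp: measurable_bounded_metric_def)
  then have "Measurable.pred N (\<lambda>\<omega>. d (X \<omega>) (W \<omega>) = 0)" by simp
  also have "(\<lambda>\<omega>. d (X \<omega>) (W \<omega>) = 0) = (\<lambda>\<omega>. X \<omega> = W \<omega>)"
    using met by (auto simp: measurable_bounded_metric_def)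
  finally show ?thesis .
qed

lemma borel_measurable_est:
  assumes met: "measurable_bounded_metric Mx d"
    and X: "\<And>n. X n \<in> N \<rightarrow>\<^sub>M Mx" and W: "\<And>n. W n \<in> N \<rightarrow>\<^sub>M Mx"
    and phi: "phi \<in> borel_measurable Mx"
  shows "(\<lambda>\<omega>. est phi k (\<lambda>j. X j \<omega>) (\<lambda>j. W j \<omega>)) \<in> borel_measurable N"
proof -
  have [measurable]: "Measurable.pred N (\<lambda>\<omega>. X n \<omega> = W n \<omega>)" for n
    by (rule pred_eq_metric[OF met X W])
  have [measurable]: "(\<lambda>\<omega>. phi (X n \<omega>)) \<in> borel_measurable N" "(\<lambda>\<omega>. phi (W n \<omega>)) \<in> borel_measurable N" for n
    using measurable_compose[OF X phi] measurable_compose[OF W phi] by auto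
  show ?thesis
    unfolding est_eq_suminf_meet meet_eq_enat_iff by measurable
qed

text \<open>The exponent \<open>4 * n\<close> in the tail bound writes the geometric rate as a fourth power, so that
  its square root can be split evenly between the terms of a series and the Cauchy--Schwarz weights.\<close>
locale coupled_pair = prob_space M for M :: "'w measure" +
  fixes Mx :: "'a measure" and d :: "'a \<Rightarrow> 'a \<Rightarrow> real" and X W :: "nat \<Rightarrow> 'w \<Rightarrow> 'a"
    and C r :: real
  assumes met: "measurable_bounded_metric Mx d"
    and X[measurable]: "\<And>n. X n \<in> M \<rightarrow>\<^sub>M Mx" and W[measurable]: "\<And>n. W n \<in> M \<rightarrow>\<^sub>M Mx"
    and faithful: "\<And>\<omega> n. \<omega> \<in> space M \<Longrightarrow> meet (\<lambda>j. X j \<omega>) (\<lambda>j. W j \<omega>) \<le> enat n \<Longrightarrow> X n \<omega> = W n \<omega>"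
    and r: "0 < r" "r < 1" and C: "1 \<le> C"
    and tail: "\<And>n. n \<ge> 1 \<Longrightarrow> prob {\<omega>\<in>space M. enat n < meet (\<lambda>j. X j \<omega>) (\<lambda>j. W j \<omega>)} \<le> C * r ^ (4 * n)"
begin

section \<open>Tails, second moment and mean of one coupled estimator\<close>

lemma pred_less_meet[measurable]: "Measurable.pred M (\<lambda>\<omega>. enat n < meet (\<lambda>j. X j \<omega>) (\<lambda>j. W j \<omega>))"
proof -
  have [measurable]: "Measurable.pred M (\<lambda>\<omega>. X n \<omega> = W n \<omega>)" for n
    by (rule pred_eq_metric[OF met X W])
  show ?thesis unfolding less_meet_iff by measurable
qed

lemma r4_LIMSEQ: "(\<lambda>n. C * r ^ (4 * n)) \<longlonglongrightarrow> 0"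
proof -
  have "(\<lambda>n. C * (r ^ 4) ^ n) \<longlonglongrightarrow> C * 0"
    using r by (intro tendsto_intros LIMSEQ_realpow_zero) (auto simp: power_less_one_iff)
  then show ?thesis by (simp add: power_mult)
qed

lemma AE_meet_finite: "AE \<omega> in M. meet (\<lambda>j. X j \<omega>) (\<lambda>j. W j \<omega>) \<noteq> \<infinity>"
proof -
  let ?m = "\<lambda>\<omega>. meet (\<lambda>j. X j \<omega>) (\<lambda>j. W j \<omega>)"
  have eq: "?m \<omega> = \<infinity> \<longleftrightarrow> (\<forall>n. enat n < ?m \<omega>)" for \<omega>
    by (cases "?m \<omega>") auto
  have [measurable]: "Measurable.pred M (\<lambda>\<omega>. ?m \<omega> = \<infinity>)" unfolding eq by measurable
  have "prob {\<omega>\<in>space M. ?m \<omega> = \<infinity>} \<le> C * r ^ (4 * n)" if "n \<ge> 1" for n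
    by (rule order_trans[OF finite_measure_mono tail[OF that]]) auto
  then have "prob {\<omega>\<in>space M. ?m \<omega> = \<infinity>} \<le> 0"
    by (intro LIMSEQ_le_const[OF r4_LIMSEQ]) auto
  then have "prob {\<omega>\<in>space M. ?m \<omega> = \<infinity>} = 0" by (simp add: measure_le_0_iff)
  then show ?thesis by (subst (asm) prob_eq_0) auto
qed

lemma AE_est:
  "AE \<omega> in M. est phi k (\<lambda>j. X j \<omega>) (\<lambda>j. W j \<omega>) = (\<Sum>n. est_term phi k (\<lambda>j. X j \<omega>) (\<lambda>j. W j \<omega>) n) \<and>
     (\<exists>N. \<forall>n\<ge>N. est_term phi k (\<lambda>j. X j \<omega>) (\<lambda>j. W j \<omega>) n = 0)"
  using AE_meet_finite AE_space
proof eventually_elim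
  case (elim \<omega>)
  then obtain t where t: "meet (\<lambda>j. X j \<omega>) (\<lambda>j. W j \<omega>) = enat t" by auto
  have "X n \<omega> = W n \<omega>" if "t \<le> n" for n
    using faithful[OF elim(2)] that by (simp add: t)
  from est_eq_suminf_term[OF t this] show ?case by blast
qed

context
  fixes phi :: "'a \<Rightarrow> real" and B :: real and k :: nat
  assumes phi[measurable]: "phi \<in> borel_measurable Mx" and B: "\<And>x. \<bar>phi x\<bar> \<le> B"
begin

abbreviation "trm n \<omega> \<equiv> est_term phi k (\<lambda>j. X j \<omega>) (\<lambda>j. W j \<omega>) n"

lemma borel_measurable_est_term[measurable]: "trm n \<in> borel_measurable M"
  unfolding est_term_def by (cases "n = 0") simp_all

lemma est_term_bound: "\<bar>trm n \<omega>\<bar> \<le> 2 * B"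
  using B[of "X (k + n) \<omega>"] B[of "W (k + n) \<omega>"] by (auto simp: est_term_def)

lemma integrable_est_term_nonzero: "integrable M (indicat_real {\<omega>\<in>space M. trm n \<omega> \<noteq> 0})"
proof -
  have "{\<omega>\<in>space M. trm n \<omega> \<noteq> 0} \<in> sets M" by measurable
  then show ?thesis by (simp add: less_top[symmetric])
qed

text \<open>For \<open>n > 0\<close>, faithfulness turns a nonzero term into the event that the pair
  has not met by time \<open>k + n\<close>. The term at 0 carries no such information, and
  \<open>1 \<le> C\<close> makes the bound trivial there.\<close>

lemma prob_est_term_nonzero: "prob {\<omega>\<in>space M. trm n \<omega> \<noteq> 0} \<le> C * r ^ (4 * n)"
proof (cases "n = 0")
  case True
  then show ?thesis using prob_le_1[of "{\<omega>\<in>space M. trm n \<omega> \<noteq> 0}"] C by (simp del: prob_le_1)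
next
  case False
  have sub: "{\<omega>\<in>space M. trm n \<omega> \<noteq> 0} \<subseteq> {\<omega>\<in>space M. enat (k + n) < meet (\<lambda>j. X j \<omega>) (\<lambda>j. W j \<omega>)}"
  proof (intro Collect_mono impI conjI)
    fix \<omega> assume a: "\<omega> \<in> space M \<and> trm n \<omega> \<noteq> 0"
    then have "X (k + n) \<omega> \<noteq> W (k + n) \<omega>" using False by (auto simp: est_term_def)
    then show "enat (k + n) < meet (\<lambda>j. X j \<omega>) (\<lambda>j. W j \<omega>)"
      using faithful[of \<omega> "k + n"] a not_le by blast
  qed auto
  have "prob {\<omega>\<in>space M. trm n \<omega> \<noteq> 0} \<le> C * r ^ (4 * (k + n))"
    by (rule order_trans[OF finite_measure_mono[OF sub] tail]) (use False in auto)
  also have "\<dots> \<le> C * r ^ (4 * n)"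
    using r C by (intro mult_left_mono power_decreasing) auto
  finally show ?thesis .
qed

lemma integrable_est_term: "integrable M (trm n)"
  by (rule integrable_const_bound[of _ "2 * B"]) (use est_term_bound in auto)

lemma summable_r4: "summable (\<lambda>n. a * r ^ (4 * n))"
proof -
  have "summable (\<lambda>n. (r ^ 4) ^ n)" using r by (intro summable_geometric) (auto simp: power_less_one_iff)
  then show ?thesis by (intro summable_mult) (simp add: power_mult)
qed

lemma est_square_integrable: "integrable M (\<lambda>\<omega>. (est phi k (\<lambda>j. X j \<omega>) (\<lambda>j. W j \<omega>))\<^sup>2)"
proof -
  have m[measurable]: "(\<lambda>\<omega>. est phi k (\<lambda>j. X j \<omega>) (\<lambda>j. W j \<omega>)) \<in> borel_measurable M"
    by (rule borel_measurable_est[OF met X W phi])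
  have v: "(\<integral>\<omega>. (trm n \<omega>)\<^sup>2 \<partial>M) \<le> (2 * B)\<^sup>2 * (C * r ^ (4 * n))" for n
  proof -
    have sq: "(trm n \<omega>)\<^sup>2 \<le> (2 * B)\<^sup>2" for \<omega>
      using power_mono[OF est_term_bound[of \<omega> n] abs_ge_zero, of 2] by simp
    have "(\<integral>\<omega>. (trm n \<omega>)\<^sup>2 \<partial>M) \<le> (\<integral>\<omega>. (2 * B)\<^sup>2 * indicator {\<omega>\<in>space M. trm n \<omega> \<noteq> 0} \<omega> \<partial>M)"
    proof (rule integral_mono)
      show "integrable M (\<lambda>\<omega>. (trm n \<omega>)\<^sup>2)"
        using sq by (intro integrable_const_bound[of _ "(2 * B)\<^sup>2"] AE_I2) auto
      fix \<omega> assume "\<omega> \<in> space M"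
      then show "(trm n \<omega>)\<^sup>2 \<le> (2 * B)\<^sup>2 * indicator {\<omega>\<in>space M. trm n \<omega> \<noteq> 0} \<omega>"
        using sq[of \<omega>] by (auto split: split_indicator)
    qed (simp add: integrable_est_term_nonzero)
    also have "\<dots> = (2 * B)\<^sup>2 * prob {\<omega>\<in>space M. trm n \<omega> \<noteq> 0}" by simp
    also have "\<dots> \<le> (2 * B)\<^sup>2 * (C * r ^ (4 * n))"
      using prob_est_term_nonzero by (intro mult_left_mono) auto
    finally show ?thesis .
  qed
  \<comment> \<open>The Cauchy-Schwarz weight \<open>r ^ n\<close> removes one of the four powers in
    the tail.\<close>
  have "summable (\<lambda>n. ((2 * B)\<^sup>2 * C) * (r ^ 3) ^ n)"
    using r by (intro summable_mult summable_geometric) (auto simp: power_less_one_iff)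
  also have "(\<lambda>n. ((2 * B)\<^sup>2 * C) * (r ^ 3) ^ n) = (\<lambda>n. (2 * B)\<^sup>2 * (C * r ^ (4 * n)) / r ^ n)"
  proof
    fix n
    have "r ^ (4 * n) = r ^ (3 * n) * r ^ n" by (simp add: power_add[symmetric])
    then show "((2 * B)\<^sup>2 * C) * (r ^ 3) ^ n = (2 * B)\<^sup>2 * (C * r ^ (4 * n)) / r ^ n"
      using r by (simp add: power_mult)
  qed
  finally have sm: "summable (\<lambda>n. (2 * B)\<^sup>2 * (C * r ^ (4 * n)) / r ^ n)" .
  have "AE \<omega> in M. \<exists>N. \<forall>n\<ge>N. trm n \<omega> = 0"
    using AE_est[of phi k] by eventually_elim simp
  then have "integrable M (\<lambda>\<omega>. (\<Sum>n. trm n \<omega>)\<^sup>2)"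
    by (rule second_moment_suminf(1)[where D="\<lambda>n \<omega>. trm n \<omega>",
          OF borel_measurable_est_term est_term_bound v r sm])
  then show ?thesis
  proof (rule integrable_cong_AE_imp)
    show "AE \<omega> in M. (\<Sum>n. trm n \<omega>)\<^sup>2 = (est phi k (\<lambda>j. X j \<omega>) (\<lambda>j. W j \<omega>))\<^sup>2"
      using AE_est[of phi k] by eventually_elim simp
  qed simp
qed

text \<open>The sequence \<open>m\<close> stands for the integrals of \<open>phi\<close> under
  \<open>nu K^n\<close>; the lag of the pair appears as \<open>Suc n\<close> against
  \<open>n\<close>, and is what makes consecutive means telescope.\<close>

lemma expectation_est:
  assumes EX: "\<And>n. expectation (\<lambda>\<omega>. phi (X n \<omega>)) = m (Suc n)"
    and EW: "\<And>n. expectation (\<lambda>\<omega>. phi (W n \<omega>)) = m n"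
    and lim: "m \<longlonglongrightarrow> I"
  shows "expectation (\<lambda>\<omega>. est phi k (\<lambda>j. X j \<omega>) (\<lambda>j. W j \<omega>)) = I"
proof -
  have [measurable]: "(\<lambda>\<omega>. est phi k (\<lambda>j. X j \<omega>) (\<lambda>j. W j \<omega>)) \<in> borel_measurable M"
    by (rule borel_measurable_est[OF met X W phi])
  have B0: "0 \<le> B" using B[of undefined] by linarith
  have iX: "integrable M (\<lambda>\<omega>. phi (X n \<omega>))" and iW: "integrable M (\<lambda>\<omega>. phi (W n \<omega>))" for n
    by (rule integrable_const_bound[of _ B]; use B in auto)+
  have Et: "expectation (trm n) = m (Suc (k + n)) - (if n = 0 then 0 else m (k + n))" for n
    using iX iW EX EW by (cases "n = 0") (simp_all add: est_term_def[abs_def])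
  have "(\<lambda>n. expectation (trm n)) sums (\<integral>\<omega>. (\<Sum>n. trm n \<omega>) \<partial>M)"
  proof (rule sums_integral)
    show "AE \<omega> in M. summable (\<lambda>n. norm (trm n \<omega>))"
      using AE_est[of phi k]
    proof eventually_elim
      case (elim \<omega>)
      then obtain N where "\<forall>n\<ge>N. trm n \<omega> = 0" by blast
      then show ?case by (intro summable_finite[of "{..<N}"]) (auto simp: not_less)
    qed
    \<comment> \<open>Each term is bounded by \<open>2 * B\<close> and lives on an event of
      geometrically small probability, which justifies integrating the series term by term.\<close>
    show "summable (\<lambda>n. \<integral>\<omega>. norm (trm n \<omega>) \<partial>M)"
    proof (rule summable_comparison_test'[OF summable_r4[of "2 * B * C"]])
      fix n
      have "(\<integral>\<omega>. norm (trm n \<omega>) \<partial>M) \<le> (\<integral>\<omega>. 2 * B * indicator {\<omega>\<in>space M. trm n \<omega> \<noteq> 0} \<omega> \<partial>M)"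
      proof (rule integral_mono)
        fix \<omega> assume "\<omega> \<in> space M"
        then show "norm (trm n \<omega>) \<le> 2 * B * indicator {\<omega>\<in>space M. trm n \<omega> \<noteq> 0} \<omega>"
          using est_term_bound[of \<omega> n] by (auto split: split_indicator)
      qed (simp_all add: integrable_est_term_nonzero integrable_est_term)
      also have "\<dots> = 2 * B * prob {\<omega>\<in>space M. trm n \<omega> \<noteq> 0}" by simp
      also have "\<dots> \<le> 2 * B * (C * r ^ (4 * n))"
        using prob_est_term_nonzero B0 by (intro mult_left_mono) auto
      finally show "norm (\<integral>\<omega>. norm (trm n \<omega>) \<partial>M) \<le> 2 * B * C * r ^ (4 * n)" by (simp add: mult.assoc)
    qed
  qed (rule integrable_est_term)
  then have "(\<lambda>N. \<Sum>n<Suc N. expectation (trm n)) \<longlonglongrightarrow> (\<integral>\<omega>. (\<Sum>n. trm n \<omega>) \<partial>M)"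
    unfolding sums_def by (rule LIMSEQ_Suc)
  \<comment> \<open>The term at 0 supplies \<open>m (Suc k)\<close> and every later one a
    difference; summing to \<open>Suc N\<close> ensures that the term at 0 is always
    present.\<close>
  moreover have "(\<Sum>n<Suc N. expectation (trm n)) = m (N + Suc k)" for N
    unfolding Et by (induction N) (simp_all add: add.commute)
  ultimately have "(\<lambda>N. m (N + Suc k)) \<longlonglongrightarrow> (\<integral>\<omega>. (\<Sum>n. trm n \<omega>) \<partial>M)" by simp
  moreover have "(\<lambda>N. m (N + Suc k)) \<longlonglongrightarrow> I" by (rule LIMSEQ_ignore_initial_segment[OF lim])
  ultimately have "(\<integral>\<omega>. (\<Sum>n. trm n \<omega>) \<partial>M) = I" by (rule LIMSEQ_unique)
  moreover have "expectation (\<lambda>\<omega>. est phi k (\<lambda>j. X j \<omega>) (\<lambda>j. W j \<omega>)) = (\<integral>\<omega>. (\<Sum>n. trm n \<omega>) \<partial>M)"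
  proof (rule integral_cong_AE)
    show "AE \<omega> in M. est phi k (\<lambda>j. X j \<omega>) (\<lambda>j. W j \<omega>) = (\<Sum>n. trm n \<omega>)"
      using AE_est[of phi k] by eventually_elim simp
  qed simp_all
  ultimately show ?thesis by simp
qed

end
end

section \<open>Increments between levels\<close>

lemma pred_quad_close:
  assumes met: "measurable_bounded_metric Mx d"
    and m: "a \<in> N \<rightarrow>\<^sub>M Mx" "b \<in> N \<rightarrow>\<^sub>M Mx" "c \<in> N \<rightarrow>\<^sub>M Mx" "e \<in> N \<rightarrow>\<^sub>M Mx"
  shows "Measurable.pred N (\<lambda>\<omega>. quad_close d \<delta> ((a \<omega>, b \<omega>), (c \<omega>, e \<omega>)))"
proof -
  have dm: "(\<lambda>\<omega>. d (x \<omega>) (y \<omega>)) \<in> borel_measurable N" if "x \<in> N \<rightarrow>\<^sub>M Mx" "y \<in> N \<rightarrow>\<^sub>M Mx" for x y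
  proof -
    have "(\<lambda>\<omega>. (\<lambda>(x, w). d x w) (x \<omega>, y \<omega>)) \<in> borel_measurable N"
      using met that by (intro measurable_compose[OF measurable_Pair]) (auto simp: measurable_bounded_metric_def)
    then show ?thesis by simp
  qed
  have [measurable]: "Measurable.pred N (\<lambda>\<omega>. d (x \<omega>) (y \<omega>) \<le> \<delta>)"
    if "x \<in> {a, b, c, e}" "y \<in> {a, b, c, e}" for x y
    using dm[of x y] that m by auto
  show ?thesis unfolding quad_close_def by simp
qed

text \<open>Being outside at time \<open>n + 1\<close> means having just left or having been outside
  at \<open>n\<close> already, so each step adds at most \<open>q\<close>.\<close>

lemma (in prob_space) prob_exit_le:
  assumes Q[measurable]: "\<And>n. Measurable.pred M (Q n)"
    and init: "prob {\<omega>\<in>space M. \<not> Q 0 \<omega>} \<le> q"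
    and step: "\<And>n. n \<ge> 1 \<Longrightarrow> prob {\<omega>\<in>space M. \<not> Q n \<omega> \<and> Q (n - 1) \<omega>} \<le> q"
  shows "prob {\<omega>\<in>space M. \<not> Q n \<omega>} \<le> (real n + 1) * q"
proof (induction n)
  case (Suc n)
  have "prob {\<omega>\<in>space M. \<not> Q (Suc n) \<omega>}
      \<le> prob ({\<omega>\<in>space M. \<not> Q (Suc n) \<omega> \<and> Q n \<omega>} \<union> {\<omega>\<in>space M. \<not> Q n \<omega>})"
    by (intro finite_measure_mono) auto
  also have "\<dots> \<le> prob {\<omega>\<in>space M. \<not> Q (Suc n) \<omega> \<and> Q n \<omega>} + prob {\<omega>\<in>space M. \<not> Q n \<omega>}"
    by (intro measure_Un_le) auto
  also have "\<dots> \<le> q + (real n + 1) * q"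
    using step[of "Suc n"] Suc by simp
  finally show ?case by (simp add: algebra_simps)
qed (use init in simp)

lemma summable_linear_geometric:
  fixes r :: real
  assumes "0 < r" "r < 1"
  shows "summable (\<lambda>n. a * (b + real n) * r ^ n)"
proof -
  have "summable (\<lambda>n. r ^ n * real n)"
    using geometric_sums_times_n[of r] assms by (auto simp: sums_iff)
  moreover have "summable (\<lambda>n. r ^ n)" using assms by (intro summable_geometric) auto
  ultimately have "summable (\<lambda>n. a * (b * r ^ n + r ^ n * real n))"
    by (intro summable_mult summable_add)
  then show ?thesis by (simp add: algebra_simps)
qed

text \<open>Each term of the difference has second moment at most \<open>p = a\<^sub>1 r\<^sup>4\<^sup>n\<close> (it vanishes once
  both chains have met) and at most \<open>q = a\<^sub>2 (k+1+n) g\<^sup>2\<close> (the four coordinates are still close); the geometric mean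
  of the two bounds is both summable in \<open>n\<close> and of order \<open>g\<close>.\<close>
lemma est_diff_second_moment:
  fixes phi :: "'a \<Rightarrow> real"
  assumes f: "coupled_pair M Mx d Xf Wf C r" and c: "coupled_pair M Mx d Xc Wc C r"
    and phi[measurable]: "phi \<in> borel_measurable Mx" and B: "\<And>x. \<bar>phi x\<bar> \<le> B"
    and lip: "\<And>x w. \<bar>phi x - phi w\<bar> \<le> \<Lambda> * d x w" and \<Lambda>: "0 \<le> \<Lambda>"
    and g: "0 \<le> g" and A: "0 \<le> A"
    and far: "\<And>j. measure M {\<omega>\<in>space M. \<not> quad_close d (A * g) ((Xf j \<omega>, Wf j \<omega>), (Xc j \<omega>, Wc j \<omega>))}
                \<le> (real j + 1) * (A * g\<^sup>2)"
  shows "(\<integral>\<omega>. (est phi k (\<lambda>j. Xf j \<omega>) (\<lambda>j. Wf j \<omega>) - est phi k (\<lambda>j. Xc j \<omega>) (\<lambda>j. Wc j \<omega>))\<^sup>2 \<partial>M)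
    \<le> g * (1 / (1 - r) * (\<Sum>n. ((16 * B\<^sup>2 * (2 * C)) * (4 * \<Lambda>\<^sup>2 * A\<^sup>2 + 16 * B\<^sup>2 * A) + 1) * (real k + 1 + real n) * r ^ n))"
proof -
  interpret f: coupled_pair M Mx d Xf Wf C r by fact
  interpret c: coupled_pair M Mx d Xc Wc C r by fact
  let ?tf = "\<lambda>n \<omega>. est_term phi k (\<lambda>j. Xf j \<omega>) (\<lambda>j. Wf j \<omega>) n"
  let ?tc = "\<lambda>n \<omega>. est_term phi k (\<lambda>j. Xc j \<omega>) (\<lambda>j. Wc j \<omega>) n"
  note tb = f.est_term_bound[OF phi B] c.est_term_bound[OF phi B]
  have [measurable]: "?tf n \<in> borel_measurable M" "?tc n \<in> borel_measurable M" for n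
    using f.borel_measurable_est_term[OF phi B] c.borel_measurable_est_term[OF phi B] by auto
  define D where "D n \<omega> = ?tf n \<omega> - ?tc n \<omega>" for n \<omega>
  have D[measurable]: "D n \<in> borel_measurable M" for n unfolding D_def by measurable
  have Db: "\<bar>D n \<omega>\<bar> \<le> 4 * B" for n \<omega>
    unfolding D_def using tb(1)[of k \<omega> n] tb(2)[of k \<omega> n] by linarith
  have Dsq: "(D n \<omega>)\<^sup>2 \<le> 16 * B\<^sup>2" for n \<omega>
    using power_mono[OF Db[of n \<omega>] abs_ge_zero, of 2] by (simp add: power_mult_distrib)
  have iD: "integrable M (\<lambda>\<omega>. (D n \<omega>)\<^sup>2)" for n
    using Dsq by (intro f.integrable_const_bound[of _ "16 * B\<^sup>2"] AE_I2) auto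
  define Q where "Q j \<omega> \<longleftrightarrow> quad_close d (A * g) ((Xf j \<omega>, Wf j \<omega>), (Xc j \<omega>, Wc j \<omega>))" for j \<omega>
  have [measurable]: "Measurable.pred M (Q j)" for j
    unfolding Q_def by (rule pred_quad_close[OF f.met f.X f.W c.X c.W])
  have ind: "integrable M (indicat_real {\<omega>\<in>space M. P \<omega>})" if [measurable]: "Measurable.pred M P" for P
    by (simp add: less_top[symmetric])
  \<comment> \<open>\<open>16 * B\<^sup>2\<close> is the square of the crude bound
    \<open>4 * B\<close> on a difference, and \<open>2 * C\<close> adds the tails of the two levels.
    In \<open>a2\<close>, the first summand comes from closeness and the second from the crude bound
    on the exit event.\<close>
  define a1 where "a1 = 16 * B\<^sup>2 * (2 * C)"
  define a2 where "a2 = 4 * \<Lambda>\<^sup>2 * A\<^sup>2 + 16 * B\<^sup>2 * A"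
  have a0: "0 \<le> a1" "0 \<le> a2" using f.C A by (auto simp: a1_def a2_def)
  have b1: "(\<integral>\<omega>. (D n \<omega>)\<^sup>2 \<partial>M) \<le> a1 * r ^ (4 * n)" for n
  proof -
    let ?U = "{\<omega>\<in>space M. ?tf n \<omega> \<noteq> 0}" and ?V = "{\<omega>\<in>space M. ?tc n \<omega> \<noteq> 0}"
    have iU: "integrable M (indicat_real ?U)" "integrable M (indicat_real ?V)"
      by (rule ind; measurable)+
    have "(\<integral>\<omega>. (D n \<omega>)\<^sup>2 \<partial>M) \<le> (\<integral>\<omega>. 16 * B\<^sup>2 * (indicator ?U \<omega> + indicator ?V \<omega>) \<partial>M)"
    proof (rule integral_mono[OF iD])
      show "integrable M (\<lambda>\<omega>. 16 * B\<^sup>2 * (indicator ?U \<omega> + indicator ?V \<omega>))"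
        using iU by (intro integrable_mult_right Bochner_Integration.integrable_add)
      fix \<omega> assume w: "\<omega> \<in> space M"
      show "(D n \<omega>)\<^sup>2 \<le> 16 * B\<^sup>2 * (indicator ?U \<omega> + indicator ?V \<omega>)"
      proof (cases "\<omega> \<in> ?U \<or> \<omega> \<in> ?V")
        case True
        then have "(1::real) \<le> indicator ?U \<omega> + indicator ?V \<omega>" by (auto split: split_indicator)
        then have "16 * B\<^sup>2 * 1 \<le> 16 * B\<^sup>2 * (indicator ?U \<omega> + indicator ?V \<omega>)"
          by (intro mult_left_mono) auto
        then show ?thesis using Dsq[of n \<omega>] by linarith
      next
        case False
        then show ?thesis using w by (simp add: D_def)
      qed
    qed
    also have "\<dots> = 16 * B\<^sup>2 * (measure M ?U + measure M ?V)"
      using iU by simp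
    also have "\<dots> \<le> 16 * B\<^sup>2 * (C * r ^ (4 * n) + C * r ^ (4 * n))"
      using f.prob_est_term_nonzero[OF phi B, of k n] c.prob_est_term_nonzero[OF phi B, of k n]
      by (intro mult_left_mono add_mono) auto
    finally show ?thesis by (simp add: a1_def)
  qed
  have b2: "(\<integral>\<omega>. (D n \<omega>)\<^sup>2 \<partial>M) \<le> a2 * (real k + 1 + real n) * g\<^sup>2" for n
  proof -
    let ?F = "{\<omega>\<in>space M. \<not> Q (k + n) \<omega>}"
    have iF: "integrable M (indicat_real ?F)" by (rule ind) measurable
    have "(\<integral>\<omega>. (D n \<omega>)\<^sup>2 \<partial>M) \<le> (\<integral>\<omega>. 4 * \<Lambda>\<^sup>2 * A\<^sup>2 * g\<^sup>2 + 16 * B\<^sup>2 * indicator ?F \<omega> \<partial>M)"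
    proof (rule integral_mono[OF iD])
      show "integrable M (\<lambda>\<omega>. 4 * \<Lambda>\<^sup>2 * A\<^sup>2 * g\<^sup>2 + 16 * B\<^sup>2 * indicator ?F \<omega>)"
        using iF by simp
      fix \<omega> assume w: "\<omega> \<in> space M"
      show "(D n \<omega>)\<^sup>2 \<le> 4 * \<Lambda>\<^sup>2 * A\<^sup>2 * g\<^sup>2 + 16 * B\<^sup>2 * indicator ?F \<omega>"
      proof (cases "Q (k + n) \<omega>")
        case True
        then have "d (Xf (k + n) \<omega>) (Xc (k + n) \<omega>) \<le> A * g" "d (Wf (k + n) \<omega>) (Wc (k + n) \<omega>) \<le> A * g"
          by (auto simp: Q_def quad_close_def)
        then have *: "\<bar>phi (Xf (k + n) \<omega>) - phi (Xc (k + n) \<omega>)\<bar> \<le> \<Lambda> * (A * g)"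
          "\<bar>phi (Wf (k + n) \<omega>) - phi (Wc (k + n) \<omega>)\<bar> \<le> \<Lambda> * (A * g)"
          by (auto intro!: order_trans[OF lip] mult_left_mono \<Lambda>)
        \<comment> \<open>The difference is regrouped across levels, X with X and W with W, because
          only closeness between levels yields a bound of order \<open>g\<close>. At
          \<open>n = 0\<close> the W part is absent.\<close>
        then have "\<bar>D n \<omega>\<bar> \<le> 2 * (\<Lambda> * (A * g))"
          unfolding D_def est_term_def by (cases "n = 0") (auto simp: abs_le_iff)
        from power_mono[OF this abs_ge_zero, of 2] show ?thesis
          by (simp add: power_mult_distrib mult.assoc add_increasing2)
      next
        case False
        then show ?thesis using Dsq[of n \<omega>] w by (simp add: add_increasing)
      qed
    qed
    also have "\<dots> = 4 * \<Lambda>\<^sup>2 * A\<^sup>2 * g\<^sup>2 + 16 * B\<^sup>2 * measure M ?F"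
      using iF by (simp add: f.prob_space)
    also have "\<dots> \<le> 4 * \<Lambda>\<^sup>2 * A\<^sup>2 * g\<^sup>2 + 16 * B\<^sup>2 * ((real (k + n) + 1) * (A * g\<^sup>2))"
      using far[of "k + n"] unfolding Q_def by (intro add_left_mono mult_left_mono) auto
    also have "\<dots> \<le> (4 * \<Lambda>\<^sup>2 * A\<^sup>2 * g\<^sup>2) * (real k + 1 + real n) + 16 * B\<^sup>2 * ((real (k + n) + 1) * (A * g\<^sup>2))"
      using mult_left_mono[of 1 "real k + 1 + real n" "4 * \<Lambda>\<^sup>2 * A\<^sup>2 * g\<^sup>2"] by simp
    also have "\<dots> = a2 * (real k + 1 + real n) * g\<^sup>2" by (simp add: a2_def algebra_simps)
    finally show ?thesis .
  qed
  \<comment> \<open>This majorises the geometric mean of the two bounds without square roots: the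
    root of \<open>a1 * a2\<close> is at most \<open>a1 * a2 + 1\<close>, and that of
    \<open>k + 1 + n\<close> is at most the number itself, as it is at least 1. The comparison is
    made between squares.\<close>
  define v where "v n = (a1 * a2 + 1) * (real k + 1 + real n) * r ^ (2 * n) * g" for n
  have v: "(\<integral>\<omega>. (D n \<omega>)\<^sup>2 \<partial>M) \<le> v n" for n
  proof (rule power2_le_imp_le)
    let ?e = "\<integral>\<omega>. (D n \<omega>)\<^sup>2 \<partial>M" and ?m = "real k + 1 + real n"
    have "?e\<^sup>2 \<le> (a1 * r ^ (4 * n)) * (a2 * ?m * g\<^sup>2)"
      unfolding power2_eq_square[of ?e] using f.r a0
      by (intro mult_mono b1 b2) auto
    also have "\<dots> = (a1 * a2) * ?m * (r ^ (4 * n) * g\<^sup>2)" by simp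
    also have "\<dots> \<le> (a1 * a2 + 1)\<^sup>2 * ?m\<^sup>2 * (r ^ (4 * n) * g\<^sup>2)"
    proof (intro mult_right_mono mult_mono)
      have "a1 * a2 + 1 \<le> (a1 * a2 + 1)\<^sup>2" using a0 by (intro self_le_power) auto
      then show "a1 * a2 \<le> (a1 * a2 + 1)\<^sup>2" by linarith
      show "?m \<le> ?m\<^sup>2" by (intro self_le_power) auto
    qed (use f.r in auto)
    also have "\<dots> = (v n)\<^sup>2"
      by (simp add: v_def power_mult_distrib power_mult[symmetric] mult.commute mult.left_commute)
    finally show "?e\<^sup>2 \<le> (v n)\<^sup>2" .
    show "0 \<le> v n" unfolding v_def using a0 f.r g by simp
  qed
  define w where "w n = (a1 * a2 + 1) * (real k + 1 + real n) * r ^ n" for n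
  have vw: "v n / r ^ n = g * w n" for n
    using f.r by (simp add: v_def w_def mult_2 power_add)
  have sw: "summable w" unfolding w_def using f.r by (intro summable_linear_geometric)
  then have sv: "summable (\<lambda>n. v n / r ^ n)" unfolding vw by (rule summable_mult)
  have fin: "AE \<omega> in M. \<exists>N. \<forall>n\<ge>N. D n \<omega> = 0"
    using f.AE_est[of phi k] c.AE_est[of phi k]
  proof eventually_elim
    case (elim \<omega>)
    then obtain N N' where "\<forall>n\<ge>N. ?tf n \<omega> = 0" "\<forall>n\<ge>N'. ?tc n \<omega> = 0" by blast
    then show ?case by (intro exI[of _ "max N N'"]) (auto simp: D_def)
  qed
  have eq: "AE \<omega> in M. est phi k (\<lambda>j. Xf j \<omega>) (\<lambda>j. Wf j \<omega>) - est phi k (\<lambda>j. Xc j \<omega>) (\<lambda>j. Wc j \<omega>) = (\<Sum>n. D n \<omega>)"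
    using f.AE_est[of phi k] c.AE_est[of phi k]
  proof eventually_elim
    case (elim \<omega>)
    then obtain N N' where N: "\<forall>n\<ge>N. ?tf n \<omega> = 0" "\<forall>n\<ge>N'. ?tc n \<omega> = 0" by blast
    have "summable (\<lambda>n. ?tf n \<omega>)"
      using N(1) by (intro summable_finite[of "{..<N}"]) (auto simp: not_less)
    moreover have "summable (\<lambda>n. ?tc n \<omega>)"
      using N(2) by (intro summable_finite[of "{..<N'}"]) (auto simp: not_less)
    ultimately show ?case using elim by (simp add: D_def suminf_diff)
  qed
  have [measurable]: "(\<lambda>\<omega>. est phi k (\<lambda>j. Xf j \<omega>) (\<lambda>j. Wf j \<omega>)) \<in> borel_measurable M"
    "(\<lambda>\<omega>. est phi k (\<lambda>j. Xc j \<omega>) (\<lambda>j. Wc j \<omega>)) \<in> borel_measurable M"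
    by (rule borel_measurable_est[OF f.met f.X f.W phi], rule borel_measurable_est[OF f.met c.X c.W phi])
  have "(\<integral>\<omega>. (est phi k (\<lambda>j. Xf j \<omega>) (\<lambda>j. Wf j \<omega>) - est phi k (\<lambda>j. Xc j \<omega>) (\<lambda>j. Wc j \<omega>))\<^sup>2 \<partial>M)
      = (\<integral>\<omega>. (\<Sum>n. D n \<omega>)\<^sup>2 \<partial>M)"
  proof (rule integral_cong_AE)
    show "AE \<omega> in M. (est phi k (\<lambda>j. Xf j \<omega>) (\<lambda>j. Wf j \<omega>) - est phi k (\<lambda>j. Xc j \<omega>) (\<lambda>j. Wc j \<omega>))\<^sup>2 = (\<Sum>n. D n \<omega>)\<^sup>2"
      using eq by eventually_elim simp
  qed simp_all
  also have "\<dots> \<le> 1 / (1 - r) * (\<Sum>n. v n / r ^ n)"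
    by (rule f.second_moment_suminf(2)[OF D Db v f.r sv fin])
  also have "\<dots> = g * (1 / (1 - r) * (\<Sum>n. w n))"
    unfolding vw suminf_mult[OF sw] by simp
  finally show ?thesis unfolding w_def a1_def a2_def .
qed

section \<open>Randomising the level\<close>

text \<open>Composing with \<open>f\<close> and \<open>h\<close> only shrinks the families of
  preimages. These are closed under intersection, so independence passes to the generated
  sigma-algebras.\<close>

lemma (in prob_space) indep_var_of_indep_set:
  assumes ind: "indep_set {X -` A \<inter> space M | A. A \<in> sets S} {V -` A \<inter> space M | A. A \<in> sets T}"
    and X: "X \<in> M \<rightarrow>\<^sub>M S" and V: "V \<in> M \<rightarrow>\<^sub>M T"
    and f: "f \<in> S \<rightarrow>\<^sub>M R" and h: "h \<in> T \<rightarrow>\<^sub>M R'"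
  shows "indep_var R (\<lambda>\<omega>. f (X \<omega>)) R' (\<lambda>\<omega>. h (V \<omega>))"
proof -
  have stable: "Int_stable {Z -` A \<inter> space M | A. A \<in> sets U}" for Z :: "'a \<Rightarrow> 'u" and U
  proof (rule Int_stableI, clarify)
    fix A B assume "A \<in> sets U" "B \<in> sets U"
    then show "\<exists>C. (Z -` A \<inter> space M) \<inter> (Z -` B \<inter> space M) = Z -` C \<inter> space M \<and> C \<in> sets U"
      by (intro exI[of _ "A \<inter> B"]) auto
  qed
  have sub: "{(\<lambda>\<omega>. f (Z \<omega>)) -` A \<inter> space M | A. A \<in> sets U'} \<subseteq> {Z -` A \<inter> space M | A. A \<in> sets U}"
    if Z: "Z \<in> M \<rightarrow>\<^sub>M U" and f: "f \<in> U \<rightarrow>\<^sub>M U'" for Z :: "'a \<Rightarrow> 'u" and U U' and f :: "'u \<Rightarrow> 'v"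
  proof clarify
    fix A assume A: "A \<in> sets U'"
    have "(\<lambda>\<omega>. f (Z \<omega>)) -` A \<inter> space M = Z -` (f -` A \<inter> space U) \<inter> space M"
      using measurable_space[OF Z] by auto
    then show "\<exists>B. (\<lambda>\<omega>. f (Z \<omega>)) -` A \<inter> space M = Z -` B \<inter> space M \<and> B \<in> sets U"
      using measurable_sets[OF f A] by blast
  qed
  have "indep_set {(\<lambda>\<omega>. f (X \<omega>)) -` A \<inter> space M | A. A \<in> sets R}
      {(\<lambda>\<omega>. h (V \<omega>)) -` A \<inter> space M | A. A \<in> sets R'}"
    using ind sub[OF X f] sub[OF V h] unfolding indep_sets2_eq by (meson subset_iff)
  from indep_set_sigma_sets[OF this stable stable] show ?thesis
    unfolding indep_var_eq using measurable_compose[OF X f] measurable_compose[OF V h] by simp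
qed

text \<open>Independence is used one level at a time:
  \<open>E[1{L = l} h(Y l)] = p l * E[h(Y l)]\<close>. The weight \<open>1 / p l\<close> cancels
  this factor in the mean, but enters squared in the second moment, leaving the series in
  \<open>sm\<close>.\<close>

lemma (in prob_space) single_term_estimator:
  fixes Y :: "nat \<Rightarrow> 'a \<Rightarrow> real" and p :: "nat pmf"
  assumes p: "\<And>l. pmf p l > 0"
    and L[measurable]: "L \<in> M \<rightarrow>\<^sub>M count_space UNIV"
    and law: "distr M (count_space UNIV) L = measure_pmf p"
    and ind: "\<And>l. indep_var borel (\<lambda>\<omega>. indicat_real {l} (L \<omega>)) borel (Y l)"
    and sq: "\<And>l. integrable M (\<lambda>\<omega>. (Y l \<omega>)\<^sup>2)"
    and sm: "summable (\<lambda>l. expectation (\<lambda>\<omega>. (Y l \<omega>)\<^sup>2) / pmf p l)"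
    and sums: "(\<lambda>l. expectation (Y l)) sums I"
  defines "S \<equiv> \<lambda>\<omega>. 1 / pmf p (L \<omega>) * Y (L \<omega>) \<omega>"
  shows "integrable M S" and "expectation S = I" and "integrable M (\<lambda>\<omega>. (S \<omega>)\<^sup>2)"
proof -
  have Y[measurable]: "Y l \<in> borel_measurable M" for l
    using ind[of l] by (simp add: indep_var_eq)
  have S[measurable]: "S \<in> borel_measurable M"
    unfolding S_def by (rule measurable_compose_countable[OF _ L]) measurable
  have iY: "integrable M (Y l)" for l
    by (rule square_integrable_imp_integrable[OF Y sq])
  have pL: "expectation (\<lambda>\<omega>. indicat_real {l} (L \<omega>)) = pmf p l" for l
  proof -
    have "expectation (\<lambda>\<omega>. indicat_real {l} (L \<omega>)) = (\<integral>x. indicat_real {l} x \<partial>distr M (count_space UNIV) L)"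
      by (rule integral_distr[symmetric]) auto
    then show ?thesis unfolding law by (simp add: pmf.rep_eq)
  qed
  have mL[measurable]: "(\<lambda>\<omega>. indicat_real {l} (L \<omega>)) \<in> borel_measurable M" for l
    by (rule measurable_compose[OF L]) simp
  have iL: "integrable M (\<lambda>\<omega>. indicat_real {l} (L \<omega>))" for l
    by (rule integrable_const_bound[of _ 1]) (auto split: split_indicator)
  have prod: "integrable M (\<lambda>\<omega>. indicat_real {l} (L \<omega>) * h (Y l \<omega>))"
      "expectation (\<lambda>\<omega>. indicat_real {l} (L \<omega>) * h (Y l \<omega>)) = pmf p l * expectation (\<lambda>\<omega>. h (Y l \<omega>))"
    if h: "h \<in> borel_measurable borel" and ih: "integrable M (\<lambda>\<omega>. h (Y l \<omega>))" for l and h :: "real \<Rightarrow> real"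
  proof -
    have iv: "indep_var borel (\<lambda>\<omega>. indicat_real {l} (L \<omega>)) borel (\<lambda>\<omega>. h (Y l \<omega>))"
      using indep_var_compose[OF ind[of l], of "\<lambda>x. x" borel h borel] h by (simp add: comp_def)
    show "integrable M (\<lambda>\<omega>. indicat_real {l} (L \<omega>) * h (Y l \<omega>))"
      by (rule indep_var_integrable[OF iv iL ih])
    show "expectation (\<lambda>\<omega>. indicat_real {l} (L \<omega>) * h (Y l \<omega>)) = pmf p l * expectation (\<lambda>\<omega>. h (Y l \<omega>))"
      using indep_var_lebesgue_integral[OF iv iL ih] by (simp add: pL)
  qed
  have sqp: "integrable M (\<lambda>\<omega>. indicat_real {l} (L \<omega>) * (Y l \<omega>)\<^sup>2)"
      "expectation (\<lambda>\<omega>. indicat_real {l} (L \<omega>) * (Y l \<omega>)\<^sup>2) = pmf p l * expectation (\<lambda>\<omega>. (Y l \<omega>)\<^sup>2)" for l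
    using prod[of "\<lambda>x. x\<^sup>2" l] sq[of l] by auto
  have "(\<integral>\<^sup>+\<omega>. ennreal ((S \<omega>)\<^sup>2) \<partial>M)
      = (\<integral>\<^sup>+\<omega>. (\<Sum>l. ennreal (indicat_real {l} (L \<omega>) * (Y l \<omega>)\<^sup>2 / (pmf p l)\<^sup>2)) \<partial>M)"
  proof (rule nn_integral_cong)
    fix \<omega>
    have "(\<Sum>l. ennreal (indicat_real {l} (L \<omega>) * (Y l \<omega>)\<^sup>2 / (pmf p l)\<^sup>2))
        = (\<Sum>l\<in>{L \<omega>}. ennreal (indicat_real {l} (L \<omega>) * (Y l \<omega>)\<^sup>2 / (pmf p l)\<^sup>2))"
      by (rule suminf_finite) (auto split: split_indicator)
    then show "ennreal ((S \<omega>)\<^sup>2) = (\<Sum>l. ennreal (indicat_real {l} (L \<omega>) * (Y l \<omega>)\<^sup>2 / (pmf p l)\<^sup>2))"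
      by (simp add: S_def power_divide)
  qed
  also have "\<dots> = (\<Sum>l. \<integral>\<^sup>+\<omega>. ennreal (indicat_real {l} (L \<omega>) * (Y l \<omega>)\<^sup>2 / (pmf p l)\<^sup>2) \<partial>M)"
    by (rule nn_integral_suminf) measurable
  also have "\<dots> = (\<Sum>l. ennreal (expectation (\<lambda>\<omega>. (Y l \<omega>)\<^sup>2) / pmf p l))"
  proof (rule suminf_cong)
    fix l
    have "(\<integral>\<^sup>+\<omega>. ennreal (indicat_real {l} (L \<omega>) * (Y l \<omega>)\<^sup>2 / (pmf p l)\<^sup>2) \<partial>M)
        = ennreal (expectation (\<lambda>\<omega>. indicat_real {l} (L \<omega>) * (Y l \<omega>)\<^sup>2 / (pmf p l)\<^sup>2))"
      using sqp(1)[of l] by (intro nn_integral_eq_integral) (auto split: split_indicator)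
    also have "expectation (\<lambda>\<omega>. indicat_real {l} (L \<omega>) * (Y l \<omega>)\<^sup>2 / (pmf p l)\<^sup>2)
        = expectation (\<lambda>\<omega>. (Y l \<omega>)\<^sup>2) / pmf p l"
      using p[of l] by (simp add: sqp(2) power2_eq_square[of "pmf p l"])
    finally show "(\<integral>\<^sup>+\<omega>. ennreal (indicat_real {l} (L \<omega>) * (Y l \<omega>)\<^sup>2 / (pmf p l)\<^sup>2) \<partial>M)
        = ennreal (expectation (\<lambda>\<omega>. (Y l \<omega>)\<^sup>2) / pmf p l)" .
  qed
  also have "\<dots> = ennreal (\<Sum>l. expectation (\<lambda>\<omega>. (Y l \<omega>)\<^sup>2) / pmf p l)"
    by (rule suminf_ennreal2[OF _ sm]) auto
  finally have nn: "(\<integral>\<^sup>+\<omega>. ennreal ((S \<omega>)\<^sup>2) \<partial>M) < \<infinity>" by simp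
  show S2: "integrable M (\<lambda>\<omega>. (S \<omega>)\<^sup>2)"
    by (rule integrableI_bounded) (use nn in auto)
  show iS: "integrable M S"
    by (rule square_integrable_imp_integrable[OF S S2])
  \<comment> \<open>The partial sums equal \<open>S\<close> on \<open>{L < N}\<close> and 0
    elsewhere, so the integrable \<open>\<bar>S \<omega>\<bar>\<close> dominates them and their
    means converge to that of \<open>S\<close>.\<close>
  have "(\<lambda>N. expectation (\<lambda>\<omega>. \<Sum>l<N. indicat_real {l} (L \<omega>) * Y l \<omega> / pmf p l)) \<longlonglongrightarrow> expectation S"
  proof (rule integral_dominated_convergence[where w="\<lambda>\<omega>. \<bar>S \<omega>\<bar>"])
    have part: "(\<Sum>l<N. indicat_real {l} (L \<omega>) * Y l \<omega> / pmf p l) = (if L \<omega> < N then S \<omega> else 0)" for N \<omega>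
    proof -
      have "(\<Sum>l<N. indicat_real {l} (L \<omega>) * Y l \<omega> / pmf p l) = (\<Sum>l<N. if L \<omega> = l then S \<omega> else 0)"
        by (rule sum.cong) (auto simp: S_def)
      then show ?thesis by simp
    qed
    show "AE \<omega> in M. (\<lambda>N. \<Sum>l<N. indicat_real {l} (L \<omega>) * Y l \<omega> / pmf p l) \<longlonglongrightarrow> S \<omega>"
    proof (rule AE_I2)
      fix \<omega>
      show "(\<lambda>N. \<Sum>l<N. indicat_real {l} (L \<omega>) * Y l \<omega> / pmf p l) \<longlonglongrightarrow> S \<omega>"
        unfolding part by (rule tendsto_eventually, rule eventually_sequentiallyI[of "Suc (L \<omega>)"]) auto
    qed
    show "AE \<omega> in M. norm (\<Sum>l<N. indicat_real {l} (L \<omega>) * Y l \<omega> / pmf p l) \<le> \<bar>S \<omega>\<bar>" for N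
      unfolding part by simp
  qed (use iS in simp_all)
  moreover have "expectation (\<lambda>\<omega>. \<Sum>l<N. indicat_real {l} (L \<omega>) * Y l \<omega> / pmf p l) = (\<Sum>l<N. expectation (Y l))" for N
  proof -
    have "expectation (\<lambda>\<omega>. indicat_real {l} (L \<omega>) * Y l \<omega> / pmf p l) = expectation (Y l)" for l
      using prod(2)[of "\<lambda>x. x" l] iY[of l] p[of l] by simp
    moreover have "integrable M (\<lambda>\<omega>. indicat_real {l} (L \<omega>) * Y l \<omega> / pmf p l)" for l
      using prod(1)[of "\<lambda>x. x" l] iY[of l] by simp
    ultimately show ?thesis by (subst Bochner_Integration.integral_sum) auto
  qed
  ultimately show "expectation S = I"
    using sums LIMSEQ_unique by (auto simp: sums_def)
qed

section \<open>Mean of an estimator at a fixed level\<close>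

text \<open>\<open>F\<close> extracts one pair from the state, so one argument covers the level-0
  chain (\<open>F\<close> the identity) and the fine and coarse pairs of an increment chain
  (\<open>fst\<close> and \<open>snd\<close>).\<close>

lemma est_unbiased:
  fixes phi :: "'a \<Rightarrow> real"
  assumes cp: "coupled_pair M Mx d X W C r" and sp: "space Mx = UNIV"
    and mc: "markov_chain M S init Kc Y" and Kc: "markov_kernel S Kc" and K: "markov_kernel Mx K"
    and F: "F \<in> S \<rightarrow>\<^sub>M Mx \<Otimes>\<^sub>M Mx" and spS: "space S = UNIV"
    and FY: "\<And>n \<omega>. F (Y n \<omega>) = (X n \<omega>, W n \<omega>)"
    and init: "distr init (Mx \<Otimes>\<^sub>M Mx) F = nucheck Mx K nut"
    and nut: "prob_space nut" "sets nut = sets (Mx \<Otimes>\<^sub>M Mx)"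
    and nu: "prob_space nu" "sets nu = sets Mx" "distr nut Mx fst = nu" "distr nut Mx snd = nu"
    and marg: "\<And>z. distr (Kc z) Mx (\<lambda>z. fst (F z)) = K (fst (F z))"
      "\<And>z. distr (Kc z) Mx (\<lambda>z. snd (F z)) = K (snd (F z))"
    and mu: "prob_space mu" "sets mu = sets Mx"
    and \<rho>: "0 < \<rho>" "\<rho> < 1"
    and erg: "\<And>x n. n \<ge> 1 \<Longrightarrow> tv_dist Mx (kpow Mx K n x) mu \<le> C' * \<rho> ^ n"
    and phi: "phi \<in> borel_measurable Mx" and B: "\<And>x. \<bar>phi x\<bar> \<le> B"
  shows "(\<integral>\<omega>. est phi k (\<lambda>j. X j \<omega>) (\<lambda>j. W j \<omega>) \<partial>M) = (\<integral>x. phi x \<partial>mu)"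
proof -
  interpret coupled_pair M Mx d X W C r by fact
  have M: "prob_space M" by unfold_locales
  have K': "K \<in> Mx \<rightarrow>\<^sub>M prob_algebra Mx" and Kc': "Kc \<in> S \<rightarrow>\<^sub>M prob_algebra S"
    using K Kc by (auto simp: markov_kernel_def)
  have F1: "(\<lambda>z. fst (F z)) \<in> S \<rightarrow>\<^sub>M Mx" and F2: "(\<lambda>z. snd (F z)) \<in> S \<rightarrow>\<^sub>M Mx"
    using measurable_compose[OF F measurable_fst] measurable_compose[OF F measurable_snd] by auto
  have law0: "distr M (Mx \<Otimes>\<^sub>M Mx) (\<lambda>\<omega>. F (Y 0 \<omega>)) = nucheck Mx K nut"
    using markov_chain_init_marginal[OF mc M F spS] init prob_space_nucheck(1)[OF K' nut] by simp
  have FY0: "(\<lambda>\<omega>. F (Y 0 \<omega>)) \<in> M \<rightarrow>\<^sub>M Mx \<Otimes>\<^sub>M Mx"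
    using mc F by (intro measurable_compose[OF _ F]) (auto simp: markov_chain_def)
  have X0: "distr M Mx (\<lambda>\<omega>. fst (F (Y 0 \<omega>))) = bind nu (kpow Mx K 1)"
  proof -
    have "distr M Mx (\<lambda>\<omega>. fst (F (Y 0 \<omega>))) = distr (nucheck Mx K nut) Mx fst"
      unfolding law0[symmetric] using distr_distr[OF measurable_fst FY0] by (simp add: comp_def)
    also have "\<dots> = bind nu K"
      using nucheck_marginals(1)[OF K' sp nut(2)] nu(3) by simp
    finally show ?thesis unfolding bind_kpow_1[OF K' nu(2)] .
  qed
  have W0: "distr M Mx (\<lambda>\<omega>. snd (F (Y 0 \<omega>))) = bind nu (kpow Mx K 0)"
  proof -
    have "distr M Mx (\<lambda>\<omega>. snd (F (Y 0 \<omega>))) = distr (nucheck Mx K nut) Mx snd"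
      unfolding law0[symmetric] using distr_distr[OF measurable_snd FY0] by (simp add: comp_def)
    also have "\<dots> = nu"
      using nucheck_marginals(2)[OF K' sp nut(2)] nu(4) by simp
    finally show ?thesis unfolding bind_kpow_0[OF nu(2)] .
  qed
  have lX: "distr M Mx (X n) = bind nu (kpow Mx K (Suc n))" for n
    using markov_chain_marginal_law[OF mc M Kc' K' F1 spS marg(1) nu(2) X0, of n] by (simp add: FY)
  have lW: "distr M Mx (W n) = bind nu (kpow Mx K n)" for n
    using markov_chain_marginal_law[OF mc M Kc' K' F2 spS marg(2) nu(2) W0, of n] by (simp add: FY)
  show ?thesis
  proof (rule expectation_est[OF phi B])
    show "expectation (\<lambda>\<omega>. phi (X n \<omega>)) = (\<integral>x. phi x \<partial>bind nu (kpow Mx K (Suc n)))" for n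
      unfolding lX[symmetric] by (rule integral_distr[symmetric, OF X phi])
    show "expectation (\<lambda>\<omega>. phi (W n \<omega>)) = (\<integral>x. phi x \<partial>bind nu (kpow Mx K n))" for n
      unfolding lW[symmetric] by (rule integral_distr[symmetric, OF W phi])
    show "(\<lambda>n. \<integral>x. phi x \<partial>bind nu (kpow Mx K n)) \<longlonglongrightarrow> (\<integral>x. phi x \<partial>mu)"
      by (rule integral_kpow_tendsto[OF K' sp nu(1,2) mu phi B \<rho> erg])
  qed
qed

section \<open>Choice of constants and assembly\<close>

theorem theorem1:
  fixes Mx :: "'a::topological_space measure"
    and d :: "'a \<Rightarrow> 'a \<Rightarrow> real"
    and K :: "nat \<Rightarrow> 'a \<Rightarrow> 'a measure"
    and pi :: "'a measure" and pil :: "nat \<Rightarrow> 'a measure"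
    and nu :: "nat \<Rightarrow> 'a measure" and nut :: "nat \<Rightarrow> ('a \<times> 'a) measure"
    and M :: "'w measure"
    and X0 W0 :: "nat \<Rightarrow> 'w \<Rightarrow> 'a"
    and Kc0 :: "'a \<times> 'a \<Rightarrow> ('a \<times> 'a) measure"
    and Xf Wf Xc Wc :: "nat \<Rightarrow> nat \<Rightarrow> 'w \<Rightarrow> 'a"
    and Kinc :: "nat \<Rightarrow> ('a \<times> 'a) \<times> ('a \<times> 'a) \<Rightarrow> (('a \<times> 'a) \<times> ('a \<times> 'a)) measure"
    and nuinc :: "nat \<Rightarrow> (('a \<times> 'a) \<times> ('a \<times> 'a)) measure"
    and k :: nat
  assumes space_Mx: "space Mx = UNIV"
    and compact_X: "compact (UNIV :: 'a set)"
    and metric: "measurable_bounded_metric Mx d"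
    and pi_prob: "prob_space pi" "sets pi = sets Mx"
    and pil_prob: "\<And>l. prob_space (pil l)" "\<And>l. sets (pil l) = sets Mx"
    and K_kernel: "\<And>l. markov_kernel Mx (K l)"
    and K_inv: "\<And>l. bind (pil l) (K l) = pil l"
    and nu_prob: "\<And>l. prob_space (nu l)" "\<And>l. sets (nu l) = sets Mx"
    and nut_prob: "\<And>s. prob_space (nut s)" "\<And>s. sets (nut s) = sets (Mx \<Otimes>\<^sub>M Mx)"
    and nut_marg: "\<And>s. distr (nut s) Mx fst = nu s" "\<And>s. distr (nut s) Mx snd = nu s"
    \<comment> \<open>level-0 coupled chain\<close>
    and M_prob: "prob_space M"
    and Kc0_kernel: "markov_kernel (Mx \<Otimes>\<^sub>M Mx) Kc0"
    and Kc0_marg: "\<And>x w. distr (Kc0 (x, w)) Mx fst = K 0 x"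
                  "\<And>x w. distr (Kc0 (x, w)) Mx snd = K 0 w"
    and chain0: "markov_chain M (Mx \<Otimes>\<^sub>M Mx) (nucheck Mx (K 0) (nut 0)) Kc0
                   (\<lambda>n \<omega>. (X0 n \<omega>, W0 n \<omega>))"
    and faithful0: "\<And>\<omega> n. \<omega> \<in> space M \<Longrightarrow> meet (\<lambda>j. X0 j \<omega>) (\<lambda>j. W0 j \<omega>) \<le> enat n
                      \<Longrightarrow> X0 n \<omega> = W0 n \<omega>"
    \<comment> \<open>increment chains, l \<ge> 1\<close>
    and Kinc_kernel: "\<And>l. l \<ge> 1 \<Longrightarrow>
                        markov_kernel ((Mx \<Otimes>\<^sub>M Mx) \<Otimes>\<^sub>M (Mx \<Otimes>\<^sub>M Mx)) (Kinc l)"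
    and Kinc_marg: "\<And>l z. l \<ge> 1 \<Longrightarrow>
                       distr (Kinc l z) Mx (\<lambda>z'. fst (fst z')) = K l (fst (fst z)) \<and>
                       distr (Kinc l z) Mx (\<lambda>z'. snd (fst z')) = K l (snd (fst z)) \<and>
                       distr (Kinc l z) Mx (\<lambda>z'. fst (snd z')) = K (l - 1) (fst (snd z)) \<and>
                       distr (Kinc l z) Mx (\<lambda>z'. snd (snd z')) = K (l - 1) (snd (snd z))"
    and nuinc_marg: "\<And>l. l \<ge> 1 \<Longrightarrow>
                       distr (nuinc l) (Mx \<Otimes>\<^sub>M Mx) fst = nucheck Mx (K l) (nut l) \<and>
                       distr (nuinc l) (Mx \<Otimes>\<^sub>M Mx) snd = nucheck Mx (K (l - 1)) (nut (l - 1))"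
    and chain_inc: "\<And>l. l \<ge> 1 \<Longrightarrow>
                      markov_chain M ((Mx \<Otimes>\<^sub>M Mx) \<Otimes>\<^sub>M (Mx \<Otimes>\<^sub>M Mx)) (nuinc l) (Kinc l)
                        (\<lambda>n \<omega>. ((Xf l n \<omega>, Wf l n \<omega>), (Xc l n \<omega>, Wc l n \<omega>)))"
    and faithful_f: "\<And>l \<omega> n. l \<ge> 1 \<Longrightarrow> \<omega> \<in> space M \<Longrightarrow>
                       meet (\<lambda>j. Xf l j \<omega>) (\<lambda>j. Wf l j \<omega>) \<le> enat n \<Longrightarrow> Xf l n \<omega> = Wf l n \<omega>"
    and faithful_c: "\<And>l \<omega> n. l \<ge> 1 \<Longrightarrow> \<omega> \<in> space M \<Longrightarrow>
                       meet (\<lambda>j. Xc l j \<omega>) (\<lambda>j. Wc l j \<omega>) \<le> enat n \<Longrightarrow> Xc l n \<omega> = Wc l n \<omega>"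
    \<comment> \<open>the level-0 chain and the increment chains are mutually independent
        (index 0: level-0 chain, duplicated in both pair slots; index l \<ge> 1: increment chain l)\<close>
    and indep_chains: "prob_space.indep_vars M
        (\<lambda>_. PiM UNIV (\<lambda>_. (Mx \<Otimes>\<^sub>M Mx) \<Otimes>\<^sub>M (Mx \<Otimes>\<^sub>M Mx)))
        (\<lambda>l \<omega>. if l = 0 then (\<lambda>n. ((X0 n \<omega>, W0 n \<omega>), (X0 n \<omega>, W0 n \<omega>)))
                else (\<lambda>n. ((Xf l n \<omega>, Wf l n \<omega>), (Xc l n \<omega>, Wc l n \<omega>))))
        UNIV"
    \<comment> \<open>(A1)\<close>
    and A1: "\<exists>C \<rho>. 0 < \<rho> \<and> \<rho> < 1 \<and>
               (\<forall>l x n. n \<ge> 1 \<longrightarrow> tv_dist Mx (kpow Mx (K l) n x) (pil l) \<le> C * \<rho> ^ n)"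
    \<comment> \<open>(A2)\<close>
    and A2: "\<exists>C \<rho>. 0 < \<rho> \<and> \<rho> < 1 \<and> (\<forall>n. n \<ge> 1 \<longrightarrow>
               measure M {\<omega> \<in> space M. enat n < meet (\<lambda>j. X0 j \<omega>) (\<lambda>j. W0 j \<omega>)} \<le> C * \<rho> ^ n \<and>
               (\<forall>l. l \<ge> 1 \<longrightarrow>
                  measure M {\<omega> \<in> space M. enat n < meet (\<lambda>j. Xf l j \<omega>) (\<lambda>j. Wf l j \<omega>)} \<le> C * \<rho> ^ n \<and>
                  measure M {\<omega> \<in> space M. enat n < meet (\<lambda>j. Xc l j \<omega>) (\<lambda>j. Wc l j \<omega>)} \<le> C * \<rho> ^ n))"
    \<comment> \<open>(A3)\<close>
    and A3: "\<exists>C. \<forall>l phi x w. phi \<in> borel_measurable Mx \<longrightarrow> bounded_fun phi \<longrightarrow> is_lip d phi \<longrightarrow>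
               \<bar>kapp (K l) phi x - kapp (K l) phi w\<bar>
                 \<le> C * max (sup_norm phi) (lip_norm d phi) * d x w"
    \<comment> \<open>(A4)\<close>
    and A4: "\<exists>C \<beta>1. 0 < \<beta>1 \<and> (\<forall>l phi. l \<ge> 1 \<longrightarrow> phi \<in> borel_measurable Mx \<longrightarrow> bounded_fun phi \<longrightarrow>
               \<bar>(\<integral>x. phi x \<partial>pil l) - (\<integral>x. phi x \<partial>pi)\<bar> \<le> C * sup_norm phi * Delta l powr \<beta>1 \<and>
               (\<forall>x. \<bar>kapp (K l) phi x - kapp (K (l - 1)) phi x\<bar> \<le> C * sup_norm phi * Delta l powr \<beta>1))"
    \<comment> \<open>(A5)\<close>
    and A5: "\<exists>C \<beta>2 \<epsilon>. 0 < \<beta>2 \<and> 0 < \<epsilon> \<and> (\<forall>l. l \<ge> 1 \<longrightarrow>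
               measure M {\<omega> \<in> space M. \<not> quad_close d (C * Delta l powr \<beta>2)
                   ((Xf l 0 \<omega>, Wf l 0 \<omega>), (Xc l 0 \<omega>, Wc l 0 \<omega>))}
                 \<le> C * Delta l powr (\<beta>2 * (2 + \<epsilon>)) \<and>
               (\<forall>n. n \<ge> 1 \<longrightarrow>
                 measure M {\<omega> \<in> space M. \<not> quad_close d (C * Delta l powr \<beta>2)
                     ((Xf l n \<omega>, Wf l n \<omega>), (Xc l n \<omega>, Wc l n \<omega>)) \<and>
                   quad_close d (C * Delta l powr \<beta>2)
                     ((Xf l (n - 1) \<omega>, Wf l (n - 1) \<omega>), (Xc l (n - 1) \<omega>, Wc l (n - 1) \<omega>))}
                 \<le> C * Delta l powr (\<beta>2 * (2 + \<epsilon>))))"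
  shows "\<exists>p :: nat pmf. (\<forall>l. pmf p l > 0) \<and>
           (\<forall>L :: 'w \<Rightarrow> nat.
              L \<in> M \<rightarrow>\<^sub>M count_space UNIV \<longrightarrow>
              distr M (count_space UNIV) L = measure_pmf p \<longrightarrow>
              prob_space.indep_set M
                {L -` A \<inter> space M | A. A \<in> sets (count_space UNIV)}
                {(\<lambda>\<omega>. \<lambda>l. if l = 0 then (\<lambda>n. ((X0 n \<omega>, W0 n \<omega>), (X0 n \<omega>, W0 n \<omega>)))
                          else (\<lambda>n. ((Xf l n \<omega>, Wf l n \<omega>), (Xc l n \<omega>, Wc l n \<omega>)))) -` A \<inter> space M
                  | A. A \<in> sets (PiM UNIV (\<lambda>_. PiM UNIV (\<lambda>_. (Mx \<Otimes>\<^sub>M Mx) \<Otimes>\<^sub>M (Mx \<Otimes>\<^sub>M Mx))))} \<longrightarrow>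
              (\<forall>phi. phi \<in> borel_measurable Mx \<longrightarrow> bounded_fun phi \<longrightarrow> is_lip d phi \<longrightarrow>
                 (let S = (\<lambda>\<omega>. (1 / pmf p (L \<omega>)) *
                        (if L \<omega> = 0 then est phi k (\<lambda>j. X0 j \<omega>) (\<lambda>j. W0 j \<omega>)
                         else est phi k (\<lambda>j. Xf (L \<omega>) j \<omega>) (\<lambda>j. Wf (L \<omega>) j \<omega>)
                              - est phi k (\<lambda>j. Xc (L \<omega>) j \<omega>) (\<lambda>j. Wc (L \<omega>) j \<omega>)))
                  in integrable M S \<and> (\<integral>\<omega>. S \<omega> \<partial>M) = (\<integral>x. phi x \<partial>pi) \<and>
                     integrable M (\<lambda>\<omega>. (S \<omega>)\<^sup>2))))"
proof -
  interpret prob_space M by (rule M_prob)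
  let ?P2 = "Mx \<Otimes>\<^sub>M Mx" and ?P4 = "(Mx \<Otimes>\<^sub>M Mx) \<Otimes>\<^sub>M (Mx \<Otimes>\<^sub>M Mx)"
  have sp2: "space ?P2 = UNIV" and sp4: "space ?P4 = UNIV"
    using space_Mx by (simp_all add: space_pair_measure)
  obtain C1 \<rho>1 where \<rho>1: "0 < \<rho>1" "\<rho>1 < 1"
    and erg: "\<And>l x n. n \<ge> 1 \<Longrightarrow> tv_dist Mx (kpow Mx (K l) n x) (pil l) \<le> C1 * \<rho>1 ^ n"
    using A1 by blast
  obtain C2 \<rho>2 where \<rho>2: "0 < \<rho>2" "\<rho>2 < 1"
    and tail0: "\<And>n. n \<ge> 1 \<Longrightarrow> prob {\<omega> \<in> space M. enat n < meet (\<lambda>j. X0 j \<omega>) (\<lambda>j. W0 j \<omega>)} \<le> C2 * \<rho>2 ^ n"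
    and tailf: "\<And>n l. n \<ge> 1 \<Longrightarrow> l \<ge> 1 \<Longrightarrow>
      prob {\<omega> \<in> space M. enat n < meet (\<lambda>j. Xf l j \<omega>) (\<lambda>j. Wf l j \<omega>)} \<le> C2 * \<rho>2 ^ n"
    and tailc: "\<And>n l. n \<ge> 1 \<Longrightarrow> l \<ge> 1 \<Longrightarrow>
      prob {\<omega> \<in> space M. enat n < meet (\<lambda>j. Xc l j \<omega>) (\<lambda>j. Wc l j \<omega>)} \<le> C2 * \<rho>2 ^ n"
    using A2 by blast
  \<comment> \<open>The fourth root puts the tail rate into the form \<open>r ^ (4 * n)\<close>
    required by \<open>coupled_pair\<close>; enlarging \<open>C2\<close> to at least 1 covers the
    term at 0.\<close>
  define r where "r = root 4 \<rho>2"
  define C where "C = max C2 1"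
  have r: "0 < r" "r < 1" using \<rho>2 by (auto simp: r_def)
  have "r ^ 4 = \<rho>2" using \<rho>2 by (simp add: r_def)
  then have r4: "r ^ (4 * n) = \<rho>2 ^ n" for n by (simp add: power_mult)
  have C: "1 \<le> C" "C2 * \<rho>2 ^ n \<le> C * r ^ (4 * n)" for n
    using \<rho>2 by (auto simp: C_def r4 intro!: mult_right_mono)
  obtain C4 \<beta>1 where \<beta>1: "0 < \<beta>1"
    and bias: "\<And>l phi. l \<ge> 1 \<Longrightarrow> phi \<in> borel_measurable Mx \<Longrightarrow> bounded_fun phi \<Longrightarrow>
       \<bar>(\<integral>x. phi x \<partial>pil l) - (\<integral>x. phi x \<partial>pi)\<bar> \<le> C4 * sup_norm phi * Delta l powr \<beta>1"
    using A4 by blast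
  obtain A \<beta> \<epsilon> where \<beta>: "0 < \<beta>" "0 < \<epsilon>"
    and far0: "\<And>l. l \<ge> 1 \<Longrightarrow> prob {\<omega> \<in> space M. \<not> quad_close d (A * Delta l powr \<beta>)
         ((Xf l 0 \<omega>, Wf l 0 \<omega>), (Xc l 0 \<omega>, Wc l 0 \<omega>))} \<le> A * Delta l powr (\<beta> * (2 + \<epsilon>))"
    and farS: "\<And>l n. l \<ge> 1 \<Longrightarrow> n \<ge> 1 \<Longrightarrow> prob {\<omega> \<in> space M. \<not> quad_close d (A * Delta l powr \<beta>)
         ((Xf l n \<omega>, Wf l n \<omega>), (Xc l n \<omega>, Wc l n \<omega>)) \<and> quad_close d (A * Delta l powr \<beta>)
         ((Xf l (n - 1) \<omega>, Wf l (n - 1) \<omega>), (Xc l (n - 1) \<omega>, Wc l (n - 1) \<omega>))}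
         \<le> A * Delta l powr (\<beta> * (2 + \<epsilon>))"
    using A5 by blast
  have Delta_pos: "0 < Delta l" and Delta_le: "Delta l \<le> 1" for l
    by (simp_all add: Delta_def powr_minus inverse_le_1_iff ge_one_powr_ge_zero)
  \<comment> \<open>\<open>A\<close> times a positive number bounds a probability, hence
    \<open>A\<close> is nonnegative.\<close>
  have A0: "0 \<le> A"
  proof -
    have "0 \<le> A * Delta 1 powr (\<beta> * (2 + \<epsilon>))"
      by (rule order_trans[OF measure_nonneg far0]) simp
    then show ?thesis using Delta_pos[of 1] by (simp add: zero_le_mult_iff)
  qed
  \<comment> \<open>\<open>s ^ l\<close> is the square root of \<open>Delta l powr \<beta>\<close>:
    one factor is absorbed by the law \<open>p\<close>, the other remains for convergence.\<close>
  define s where "s = 2 powr (- \<beta> / 2)"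
  have s: "0 < s" "s < 1" using \<beta> by (auto simp: s_def powr_less_one)
  have Delta_s: "Delta l powr \<beta> = s ^ l * s ^ l" for l
  proof -
    have "s ^ l * s ^ l = s powr (real l + real l)"
      unfolding powr_add using s by (simp add: powr_realpow)
    also have "\<dots> = Delta l powr \<beta>"
      unfolding s_def Delta_def powr_powr by (simp add: field_simps)
    finally show ?thesis ..
  qed
  define p where "p = geometric_pmf (1 - s)"
  have p: "pmf p l = s ^ l * (1 - s)" for l
    unfolding p_def using s by (subst pmf_geometric) auto

  have chain0_X: "X0 n \<in> M \<rightarrow>\<^sub>M Mx" "W0 n \<in> M \<rightarrow>\<^sub>M Mx" for n
  proof -
    have "(\<lambda>\<omega>. (X0 n \<omega>, W0 n \<omega>)) \<in> M \<rightarrow>\<^sub>M ?P2" using chain0 by (simp add: markov_chain_def)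
    from measurable_compose[OF this measurable_fst] measurable_compose[OF this measurable_snd]
    show "X0 n \<in> M \<rightarrow>\<^sub>M Mx" "W0 n \<in> M \<rightarrow>\<^sub>M Mx" by simp_all
  qed
  have chain_X: "Xf l n \<in> M \<rightarrow>\<^sub>M Mx" "Wf l n \<in> M \<rightarrow>\<^sub>M Mx" "Xc l n \<in> M \<rightarrow>\<^sub>M Mx" "Wc l n \<in> M \<rightarrow>\<^sub>M Mx"
    if l: "l \<ge> 1" for l n
  proof -
    have Z: "(\<lambda>\<omega>. ((Xf l n \<omega>, Wf l n \<omega>), (Xc l n \<omega>, Wc l n \<omega>))) \<in> M \<rightarrow>\<^sub>M ?P4"
      using chain_inc[OF l] by (simp add: markov_chain_def)
    note 1 = measurable_compose[OF Z measurable_fst] measurable_compose[OF Z measurable_snd]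
    from measurable_compose[OF 1(1) measurable_fst] measurable_compose[OF 1(1) measurable_snd]
      measurable_compose[OF 1(2) measurable_fst] measurable_compose[OF 1(2) measurable_snd]
    show "Xf l n \<in> M \<rightarrow>\<^sub>M Mx" "Wf l n \<in> M \<rightarrow>\<^sub>M Mx" "Xc l n \<in> M \<rightarrow>\<^sub>M Mx" "Wc l n \<in> M \<rightarrow>\<^sub>M Mx" by simp_all
  qed
  have cp0: "coupled_pair M Mx d X0 W0 C r"
    by unfold_locales (use metric chain0_X faithful0 r C order_trans[OF tail0 C(2)] in auto)
  have cpf: "coupled_pair M Mx d (Xf l) (Wf l) C r" if l: "l \<ge> 1" for l
    by unfold_locales (use metric chain_X[OF l] faithful_f[OF l] r C order_trans[OF tailf[OF _ l] C(2)] in auto)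
  have cpc: "coupled_pair M Mx d (Xc l) (Wc l) C r" if l: "l \<ge> 1" for l
    by unfold_locales (use metric chain_X[OF l] faithful_c[OF l] r C order_trans[OF tailc[OF _ l] C(2)] in auto)
  have far: "prob {\<omega>\<in>space M. \<not> quad_close d (A * Delta l powr \<beta>) ((Xf l j \<omega>, Wf l j \<omega>), (Xc l j \<omega>, Wc l j \<omega>))}
      \<le> (real j + 1) * (A * (Delta l powr \<beta>)\<^sup>2)" if l: "l \<ge> 1" for l j
  proof -
    \<comment> \<open>Since \<open>Delta l \<le> 1\<close>, the larger exponent gives the smaller
      power, and the exit bound takes the form \<open>A * g\<^sup>2\<close> with
      \<open>g = Delta l powr \<beta>\<close>.\<close>
    have "Delta l powr (\<beta> * (2 + \<epsilon>)) \<le> Delta l powr (\<beta> * 2)"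
      using Delta_pos[of l] Delta_le[of l] \<beta> by (intro powr_mono') (auto simp: less_imp_le)
    also have "\<dots> = (Delta l powr \<beta>)\<^sup>2"
      unfolding mult_2_right powr_add power2_eq_square ..
    finally have le: "A * Delta l powr (\<beta> * (2 + \<epsilon>)) \<le> A * (Delta l powr \<beta>)\<^sup>2"
      using A0 by (intro mult_left_mono)
    show ?thesis
    proof (rule prob_exit_le)
      show "Measurable.pred M (\<lambda>\<omega>. quad_close d (A * Delta l powr \<beta>) ((Xf l n \<omega>, Wf l n \<omega>), (Xc l n \<omega>, Wc l n \<omega>)))" for n
        by (rule pred_quad_close[OF metric chain_X[OF l]])
    qed (use order_trans[OF far0[OF l] le] order_trans[OF farS[OF l] le] in auto)
  qed

  let ?V = "\<lambda>\<omega>. \<lambda>l. if l = 0 then (\<lambda>n. ((X0 n \<omega>, W0 n \<omega>), (X0 n \<omega>, W0 n \<omega>)))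
                          else (\<lambda>n. ((Xf l n \<omega>, Wf l n \<omega>), (Xc l n \<omega>, Wc l n \<omega>)))"
  let ?T = "PiM UNIV (\<lambda>_::nat. PiM UNIV (\<lambda>_::nat. ?P4))"
  \<comment> \<open>Measurability of each component path is part of the independence of the
    chains.\<close>
  have V: "?V \<in> M \<rightarrow>\<^sub>M ?T"
    by (rule measurable_abs_UNIV) (use indep_chains in \<open>simp add: indep_vars_def\<close>)

  show ?thesis
  proof (intro exI[of _ p] conjI allI impI)
    show "pmf p l > 0" for l using s by (simp add: p)
  next
    fix L :: "'w \<Rightarrow> nat" and phi :: "'a \<Rightarrow> real"
    assume L: "L \<in> M \<rightarrow>\<^sub>M count_space UNIV" and law: "distr M (count_space UNIV) L = measure_pmf p"
      and ind: "indep_set {L -` A \<inter> space M | A. A \<in> sets (count_space UNIV)} {?V -` A \<inter> space M | A. A \<in> sets ?T}"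
      and phi: "phi \<in> borel_measurable Mx" and bdd: "bounded_fun phi" and lip: "is_lip d phi"
    obtain B where B: "\<And>x. \<bar>phi x\<bar> \<le> B" using bdd by (auto simp: bounded_fun_def)
    obtain c0 where c0: "\<And>x w. \<bar>phi x - phi w\<bar> \<le> c0 * d x w" using lip by (auto simp: is_lip_def)
    have lip': "\<bar>phi x - phi w\<bar> \<le> \<bar>c0\<bar> * d x w" for x w
    proof -
      have "0 \<le> d x w" using metric by (simp add: measurable_bounded_metric_def)
      then have "c0 * d x w \<le> \<bar>c0\<bar> * d x w" by (intro mult_right_mono) auto
      then show ?thesis using c0[of x w] by linarith
    qed
    define Y where "Y l \<omega> = (if l = 0 then est phi k (\<lambda>j. X0 j \<omega>) (\<lambda>j. W0 j \<omega>)
        else est phi k (\<lambda>j. Xf l j \<omega>) (\<lambda>j. Wf l j \<omega>) - est phi k (\<lambda>j. Xc l j \<omega>) (\<lambda>j. Wc l j \<omega>))" for l \<omega>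
    have sq0: "integrable M (\<lambda>\<omega>. (est phi k (\<lambda>j. X0 j \<omega>) (\<lambda>j. W0 j \<omega>))\<^sup>2)"
      by (rule coupled_pair.est_square_integrable[OF cp0 phi B])
    have mf: "(\<lambda>\<omega>. est phi k (\<lambda>j. Xf l j \<omega>) (\<lambda>j. Wf l j \<omega>)) \<in> borel_measurable M"
      and mc: "(\<lambda>\<omega>. est phi k (\<lambda>j. Xc l j \<omega>) (\<lambda>j. Wc l j \<omega>)) \<in> borel_measurable M"
      if l: "l \<ge> 1" for l
      using chain_X[OF l] by (auto intro!: borel_measurable_est[OF metric _ _ phi])
    have sqf: "integrable M (\<lambda>\<omega>. (est phi k (\<lambda>j. Xf l j \<omega>) (\<lambda>j. Wf l j \<omega>))\<^sup>2)"
      and sqc: "integrable M (\<lambda>\<omega>. (est phi k (\<lambda>j. Xc l j \<omega>) (\<lambda>j. Wc l j \<omega>))\<^sup>2)" if l: "l \<ge> 1" for l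
      by (rule coupled_pair.est_square_integrable[OF cpf[OF l] phi B],
          rule coupled_pair.est_square_integrable[OF cpc[OF l] phi B])
    have sqY: "integrable M (\<lambda>\<omega>. (Y l \<omega>)\<^sup>2)" for l
    proof (cases "l = 0")
      case True
      then show ?thesis using sq0 by (simp add: Y_def)
    next
      case False
      then have l: "l \<ge> 1" by simp
      let ?e = "\<lambda>\<omega>. est phi k (\<lambda>j. Xf l j \<omega>) (\<lambda>j. Wf l j \<omega>)" and ?e' = "\<lambda>\<omega>. est phi k (\<lambda>j. Xc l j \<omega>) (\<lambda>j. Wc l j \<omega>)"
      have "integrable M (\<lambda>\<omega>. 2 * (?e \<omega>)\<^sup>2 + 2 * (?e' \<omega>)\<^sup>2)"
        using sqf[OF l] sqc[OF l] by simp
      moreover have "(\<lambda>\<omega>. (?e \<omega> - ?e' \<omega>)\<^sup>2) \<in> borel_measurable M" using mf[OF l] mc[OF l] by measurable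
      moreover have "AE \<omega> in M. norm ((?e \<omega> - ?e' \<omega>)\<^sup>2) \<le> norm (2 * (?e \<omega>)\<^sup>2 + 2 * (?e' \<omega>)\<^sup>2)"
      proof (rule AE_I2)
        fix \<omega>
        have "0 \<le> (?e \<omega> + ?e' \<omega>)\<^sup>2" by simp
        then have "(?e \<omega> - ?e' \<omega>)\<^sup>2 \<le> 2 * (?e \<omega>)\<^sup>2 + 2 * (?e' \<omega>)\<^sup>2"
          unfolding power2_sum power2_diff by linarith
        then show "norm ((?e \<omega> - ?e' \<omega>)\<^sup>2) \<le> norm (2 * (?e \<omega>)\<^sup>2 + 2 * (?e' \<omega>)\<^sup>2)"
          by simp
      qed
      ultimately have "integrable M (\<lambda>\<omega>. (?e \<omega> - ?e' \<omega>)\<^sup>2)" by (rule Bochner_Integration.integrable_bound)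
      then show ?thesis using False by (simp add: Y_def)
    qed
    \<comment> \<open>\<open>H\<close> does not depend on \<open>l\<close>; the level enters the
      second moment only through \<open>g\<close>.\<close>
    define H where "H = 1 / (1 - r) * (\<Sum>n. ((16 * B\<^sup>2 * (2 * C)) * (4 * \<bar>c0\<bar>\<^sup>2 * A\<^sup>2 + 16 * B\<^sup>2 * A) + 1) * (real k + 1 + real n) * r ^ n)"
    have EY: "expectation (\<lambda>\<omega>. (Y l \<omega>)\<^sup>2) \<le> s ^ l * s ^ l * H" if l: "l \<ge> 1" for l
      using est_diff_second_moment[OF cpf[OF l] cpc[OF l] phi B lip' abs_ge_zero powr_ge_zero A0 far[OF l], where k=k] l
      unfolding H_def Delta_s[symmetric] Y_def by simp
    have smY: "summable (\<lambda>l. expectation (\<lambda>\<omega>. (Y l \<omega>)\<^sup>2) / pmf p l)"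
    proof (rule summable_comparison_test'[where N=1])
      show "summable (\<lambda>l. H / (1 - s) * s ^ l)"
        using s by (intro summable_mult summable_geometric) auto
      fix l :: nat assume l: "1 \<le> l"
      have "expectation (\<lambda>\<omega>. (Y l \<omega>)\<^sup>2) / pmf p l \<le> s ^ l * s ^ l * H / (s ^ l * (1 - s))"
        unfolding p using EY[OF l] s by (intro divide_right_mono) auto
      also have "\<dots> = H / (1 - s) * s ^ l" using s by (simp add: field_simps)
      finally show "norm (expectation (\<lambda>\<omega>. (Y l \<omega>)\<^sup>2) / pmf p l) \<le> H / (1 - s) * s ^ l"
        by simp
    qed
    have E0: "expectation (\<lambda>\<omega>. est phi k (\<lambda>j. X0 j \<omega>) (\<lambda>j. W0 j \<omega>)) = (\<integral>x. phi x \<partial>pil 0)"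
    proof (rule est_unbiased[OF cp0 space_Mx chain0 Kc0_kernel K_kernel _ sp2 _ _ nut_prob nu_prob nut_marg _ _ pil_prob \<rho>1 erg phi B, where F="\<lambda>z. z"])
      have "sets (nucheck Mx (K 0) (nut 0)) = sets ?P2"
        using prob_space_nucheck(2)[OF _ nut_prob] K_kernel by (simp add: markov_kernel_def)
      then show "distr (nucheck Mx (K 0) (nut 0)) ?P2 (\<lambda>z. z) = nucheck Mx (K 0) (nut 0)"
        by (intro distr_id2) simp
      show "distr (Kc0 z) Mx (\<lambda>z. fst z) = K 0 (fst z)" "distr (Kc0 z) Mx (\<lambda>z. snd z) = K 0 (snd z)" for z
        using Kc0_marg[of "fst z" "snd z"] by simp_all
    qed auto
    have Ef: "expectation (\<lambda>\<omega>. est phi k (\<lambda>j. Xf l j \<omega>) (\<lambda>j. Wf l j \<omega>)) = (\<integral>x. phi x \<partial>pil l)" if l: "l \<ge> 1" for l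
      by (rule est_unbiased[OF cpf[OF l] space_Mx chain_inc[OF l] Kinc_kernel[OF l] K_kernel measurable_fst sp4
            _ _ nut_prob nu_prob nut_marg _ _ pil_prob \<rho>1 erg phi B])
        (use nuinc_marg[OF l] Kinc_marg[OF l] in auto)
    have Ec: "expectation (\<lambda>\<omega>. est phi k (\<lambda>j. Xc l j \<omega>) (\<lambda>j. Wc l j \<omega>)) = (\<integral>x. phi x \<partial>pil (l - 1))" if l: "l \<ge> 1" for l
      by (rule est_unbiased[OF cpc[OF l] space_Mx chain_inc[OF l] Kinc_kernel[OF l] K_kernel measurable_snd sp4
            _ _ nut_prob nu_prob nut_marg _ _ pil_prob \<rho>1 erg phi B])
        (use nuinc_marg[OF l] Kinc_marg[OF l] in auto)
    have EYl: "expectation (Y l) = (\<integral>x. phi x \<partial>pil l) - (if l = 0 then 0 else (\<integral>x. phi x \<partial>pil (l - 1)))" for l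
    proof (cases "l = 0")
      case True
      then show ?thesis using E0 by (simp add: Y_def[abs_def])
    next
      case False
      then have l: "l \<ge> 1" by simp
      show ?thesis
        using False Ef[OF l] Ec[OF l] square_integrable_imp_integrable[OF mf[OF l] sqf[OF l]]
          square_integrable_imp_integrable[OF mc[OF l] sqc[OF l]]
        by (simp add: Y_def[abs_def])
    qed
    have lim: "(\<lambda>l. \<integral>x. phi x \<partial>pil l) \<longlonglongrightarrow> (\<integral>x. phi x \<partial>pi)"
    proof (rule LIM_zero_cancel, rule Lim_null_comparison)
      show "\<forall>\<^sub>F l in sequentially. norm ((\<integral>x. phi x \<partial>pil l) - (\<integral>x. phi x \<partial>pi)) \<le> C4 * sup_norm phi * Delta l powr \<beta>1"
        using bias[OF _ phi bdd] unfolding real_norm_def by (rule eventually_sequentiallyI[of 1])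
      define q where "q = 2 powr (- \<beta>1)"
      have q: "0 < q" "q < 1" using \<beta>1 by (auto simp: q_def powr_less_one)
      have "Delta l powr \<beta>1 = q ^ l" for l
      proof -
        have "q ^ l = q powr real l" using q by (simp add: powr_realpow)
        also have "\<dots> = Delta l powr \<beta>1" unfolding q_def Delta_def powr_powr by (simp add: mult.commute)
        finally show ?thesis ..
      qed
      moreover have "(\<lambda>l. C4 * sup_norm phi * q ^ l) \<longlonglongrightarrow> C4 * sup_norm phi * 0"
        using q by (intro tendsto_intros LIMSEQ_realpow_zero) auto
      ultimately show "(\<lambda>l. C4 * sup_norm phi * Delta l powr \<beta>1) \<longlonglongrightarrow> 0" by simp
    qed
    have sumsY: "(\<lambda>l. expectation (Y l)) sums (\<integral>x. phi x \<partial>pi)"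
    proof -
      \<comment> \<open>Level 0 contributes the integral under \<open>pil 0\<close>, each later
        level a difference of neighbouring integrals, so the sum collapses to the one under
        \<open>pil N\<close>.\<close>
      have "(\<Sum>l<Suc N. expectation (Y l)) = (\<integral>x. phi x \<partial>pil N)" for N
        unfolding EYl by (induction N) simp_all
      then have "(\<lambda>N. \<Sum>l<Suc N. expectation (Y l)) \<longlonglongrightarrow> (\<integral>x. phi x \<partial>pi)" using lim by simp
      then show ?thesis unfolding sums_def by (rule LIMSEQ_imp_Suc)
    qed
    have indY: "indep_var borel (\<lambda>\<omega>. indicat_real {l} (L \<omega>)) borel (Y l)" for l
    proof -
      \<comment> \<open>\<open>G\<close> recovers \<open>Y l\<close> from the joint path of all
        chains, to which the independence of \<open>L\<close> refers. At level 0 both slots hold the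
        same pair, so only the first is read.\<close>
      define G :: "(nat \<Rightarrow> nat \<Rightarrow> ('a \<times> 'a) \<times> ('a \<times> 'a)) \<Rightarrow> real" where
        "G v = est phi k (\<lambda>j. fst (fst (v l j))) (\<lambda>j. snd (fst (v l j)))
          - (if l = 0 then 0 else est phi k (\<lambda>j. fst (snd (v l j))) (\<lambda>j. snd (snd (v l j))))" for v
      have comp: "(\<lambda>v. v l j) \<in> ?T \<rightarrow>\<^sub>M ?P4" for j
        by (rule measurable_compose[of "\<lambda>v. v l" ?T "PiM UNIV (\<lambda>_. ?P4)" "\<lambda>h. h j"]) auto
      have pr: "(\<lambda>v. fst (fst (v l j))) \<in> ?T \<rightarrow>\<^sub>M Mx" "(\<lambda>v. snd (fst (v l j))) \<in> ?T \<rightarrow>\<^sub>M Mx"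
          "(\<lambda>v. fst (snd (v l j))) \<in> ?T \<rightarrow>\<^sub>M Mx" "(\<lambda>v. snd (snd (v l j))) \<in> ?T \<rightarrow>\<^sub>M Mx" for j
        using comp[of j] by measurable
      have G: "G \<in> borel_measurable ?T"
        using borel_measurable_est[OF metric pr(1,2) phi, of k] borel_measurable_est[OF metric pr(3,4) phi, of k]
        unfolding G_def by (cases "l = 0") simp_all
      have "(\<lambda>\<omega>. G (?V \<omega>)) = Y l"
        by (cases "l = 0") (simp_all add: G_def Y_def fun_eq_iff)
      then show ?thesis
        using indep_var_of_indep_set[OF ind L V, of "indicat_real {l}" borel G borel] G by simp
    qed
    have "pmf p l > 0" for l using s by (simp add: p)
    from single_term_estimator[OF this L law indY sqY smY sumsY]
    show "let S = (\<lambda>\<omega>. (1 / pmf p (L \<omega>)) *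
                        (if L \<omega> = 0 then est phi k (\<lambda>j. X0 j \<omega>) (\<lambda>j. W0 j \<omega>)
                         else est phi k (\<lambda>j. Xf (L \<omega>) j \<omega>) (\<lambda>j. Wf (L \<omega>) j \<omega>)
                              - est phi k (\<lambda>j. Xc (L \<omega>) j \<omega>) (\<lambda>j. Wc (L \<omega>) j \<omega>)))
                  in integrable M S \<and> (\<integral>\<omega>. S \<omega> \<partial>M) = (\<integral>x. phi x \<partial>pi) \<and>
                     integrable M (\<lambda>\<omega>. (S \<omega>)\<^sup>2)"
      unfolding Let_def Y_def by (intro conjI)
  qed
qed

end
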